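(* Let $\Gamma$ be a graph, and let $\gamma\colon C\to\Gamma$ be a closed edge-path immersed in $\Gamma$. Assume that - the girth of $\Gamma$ is $\geq 2\pi$, and - each two points $x,y$ in $\gamma(C)$ are at distance $\leq\pi$ in $\Gamma$. Then the length of $\gamma$ is commensurable with $\pi$.
   Context: By a graph is meant a (possibly infinite) metric graph with finitely many possible edge lengths. The girth is the minimal length of a cycle, i.e. of a closed edge-path embedded in the graph. Here $C$ is a circle and "immersed" means that $\gamma$ is locally injective. The points $x,y$ are arbitrary points (not only vertices), and distance in $\Gamma$ is the length (path) metric. A length is commensurable with $\pi$ if it is a rational multiple of $\pi$. *)

theory Defs
  imports "HOL-Analysis.Analysis" "Graph_Theory.Bidirected_Digraph" "Graph_Theory.Arc_Walk"
begin

definition locally_injective_on :: "('a::topological_space \<Rightarrow> 'b) \<Rightarrow> 'a set \<Rightarrow> bool" where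
  "locally_injective_on f S \<longleftrightarrow> (\<forall>x\<in>S. \<exists>U. open U \<and> x \<in> U \<and> inj_on f (U \<inter> S))"

definition commensurable :: "real \<Rightarrow> real \<Rightarrow> bool" where
  "commensurable x y \<longleftrightarrow> (\<exists>q\<in>\<rat>. x = q * y)"

text \<open>
  Points of a metric graph. An edge is a pair of mutually inverse arcs, so an interior point
  of an edge has two coordinates, one for each orientation;
  \<open>Interior\<close> carries the set of these two.
\<close>
datatype ('v, 'e) mg_point = Vertex 'v | Interior "('e \<times> real) set"

text \<open>
  A metric graph, possibly infinite, with loops and multiple edges allowed and connectedness not
  required: \<open>arcs G\<close> are the oriented edges and \<open>arev\<close> reverses the orientation.
  It acts on the arcs without fixed points, so a loop also consists of two arcs.
\<close>
locale metric_graph = bidirected_digraph G arev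
  for G :: "('v, 'e) pre_digraph" and arev :: "'e \<Rightarrow> 'e" +
  fixes len :: "'e \<Rightarrow> real"
  assumes len_pos: "a \<in> arcs G \<Longrightarrow> 0 < len a"
    and len_arev: "a \<in> arcs G \<Longrightarrow> len (arev a) = len a"
    and finite_len: "finite (len ` arcs G)"
begin

text \<open>The characteristic map from \<open>[0, len a]\<close> onto the closed edge \<open>a\<close>.\<close>
definition pt :: "'e \<Rightarrow> real \<Rightarrow> ('v, 'e) mg_point" where
  "pt a t = (if t \<le> 0 then Vertex (tail G a)
             else if len a \<le> t then Vertex (head G a)
             else Interior {(a, t), (arev a, len a - t)})"

lemma pt_arev: "a \<in> arcs G \<Longrightarrow> pt (arev a) (len a - t) = pt a t"
  using len_pos[of a] by (auto simp: pt_def len_arev)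

definition points :: "('v, 'e) mg_point set" where
  "points = Vertex ` verts G \<union> (\<Union>a\<in>arcs G. pt a ` {0..len a})"

text \<open>
  \<open>pl_path x r y\<close>: there is a piecewise linear path of length \<open>r\<close> from \<open>x\<close> to \<open>y\<close>, i.e. a finite
  concatenation of linear segments, each inside one closed edge.
\<close>
inductive pl_path :: "('v, 'e) mg_point \<Rightarrow> real \<Rightarrow> ('v, 'e) mg_point \<Rightarrow> bool" where
  trivial: "x \<in> points \<Longrightarrow> pl_path x 0 x"
| segment: "pl_path x r (pt a s) \<Longrightarrow> a \<in> arcs G \<Longrightarrow> s \<in> {0..len a} \<Longrightarrow> t \<in> {0..len a}
            \<Longrightarrow> pl_path x (r + \<bar>t - s\<bar>) (pt a t)"

text \<open>The length metric; its value is \<open>\<infinity>\<close> for points in different components.\<close>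
definition mg_dist :: "('v, 'e) mg_point \<Rightarrow> ('v, 'e) mg_point \<Rightarrow> ereal" where
  "mg_dist x y = Inf {ereal r | r. pl_path x r y}"

definition edge_path_length :: "'e list \<Rightarrow> real" where
  "edge_path_length p = sum_list (map len p)"

text \<open>The arc length parametrisation of an edge-path, on \<open>[0, edge_path_length p]\<close>.\<close>
fun edge_path_map :: "'e list \<Rightarrow> real \<Rightarrow> ('v, 'e) mg_point" where
  "edge_path_map [] t = undefined"
| "edge_path_map [a] t = pt a t"
| "edge_path_map (a # b # p) t =
     (if t \<le> len a then pt a t else edge_path_map (b # p) (t - len a))"

text \<open>
  The map from the unit circle to the graph given by a closed edge-path, parametrised with
  constant speed and with base point \<open>1\<close>.
\<close>
definition circle_map :: "'e list \<Rightarrow> complex \<Rightarrow> ('v, 'e) mg_point" where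
  "circle_map p z = edge_path_map p (edge_path_length p * (Arg2pi z / (2 * pi)))"

definition immersed :: "'e list \<Rightarrow> bool" where
  "immersed p \<longleftrightarrow> locally_injective_on (circle_map p) (sphere 0 1)"

definition embedded :: "'e list \<Rightarrow> bool" where
  "embedded p \<longleftrightarrow> inj_on (circle_map p) (sphere 0 1)"

text \<open>The girth is \<open>\<infinity>\<close> if there are no cycles.\<close>
definition girth :: ereal where
  "girth = Inf {ereal (edge_path_length p) | p. closed_w p \<and> embedded p}"

end

end

theory Submission
  imports Defs
begin

text \<open>
  Let \<open>d\<close> be the distance in the graph, and let \<open>\<alpha>\<close>, \<open>\<beta>\<close> be closed walks without backtracking in the image of
  \<open>\<gamma>\<close>. Because of the girth, \<open>d(\<alpha>(s), \<beta>(t))\<close> has slopes \<open>\<plusminus>1\<close> in both variables, and since it never exceeds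
  \<open>pi\<close>, the set where it equals \<open>pi\<close> cuts the torus of all \<open>(s, t)\<close> into squares with centres at pairs of
  vertices and half-diagonals \<open>r = pi - d\<close>, and rectangles belonging to the overlaps of \<open>\<alpha>\<close> and \<open>\<beta>\<close>. As in Dehn's
  theorem on tilings by squares, the resulting area formula persists for every additive
  \<open>\<phi> :: real \<Rightarrow> real\<close>:
  \<open>\<phi>(|\<alpha>|) \<phi>(|\<beta>|) = 2 \<Sum> \<phi>(r)\<^sup>2 + 2 \<phi>(pi) \<Sum> (\<phi>(len e) - \<phi>(pi))\<close>, where the first sum also has a term
  with \<open>r = pi\<close> for each common vertex and the second runs over the common edges.

  For a simple cycle \<open>\<alpha> = \<beta> = A\<close> this gives \<open>\<phi>(|A|)\<^sup>2 \<ge> 2 \<phi>(pi) \<phi>(|A|)\<close>, so \<open>\<phi>(pi) = \<phi>(|A|) = 1\<close> is impossible and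
  \<open>|A|\<close> is commensurable with \<open>pi\<close>. If \<open>|\<gamma>|\<close> is not, choose \<open>f\<close> with \<open>f(pi) = 0\<close> and \<open>f(|\<gamma>|) = 1\<close>. Then
  \<open>f(|A|) = 0\<close>, and comparing the formulas for \<open>id\<close>, \<open>f\<close> and \<open>id + f\<close> yields \<open>|A| f(|\<gamma>|) = 2 pi f(S)\<close>,
  where \<open>S\<close> is the length of \<open>\<gamma>\<close> inside \<open>A\<close>. Replacing each passage of \<open>\<gamma>\<close> along \<open>A\<close> by the
  complementary arc changes the sign of \<open>f(S)\<close>, hence of \<open>f(|\<gamma>|)\<close>, while the formula for \<open>f\<close> shows that
  \<open>f(|\<alpha>|) f(|\<beta>|) \<ge> 0\<close> for all \<open>\<alpha>\<close>, \<open>\<beta>\<close>: a contradiction.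
\<close>

section \<open>Rectangles covered by corner triangles\<close>

text \<open>
  An edge of length \<open>a\<close> has ends at distances \<open>pi - p\<close> and \<open>pi - q\<close> from a vertex. The sign is \<open>-1\<close> iff
  a geodesic from the first end to the vertex runs along the edge.
\<close>
definition side_sign :: "real \<Rightarrow> real \<Rightarrow> real \<Rightarrow> real" where
  "side_sign a p q = (if q = p + a then -1 else 1)"

text \<open>
  The product of two edges of lengths \<open>a\<close> and \<open>b\<close>: \<open>p_ij\<close> is \<open>pi\<close> minus the distance between the ends
  \<open>i\<close> and \<open>j\<close>. Since distances are at most \<open>pi\<close>, the four triangles of legs \<open>p_ij\<close> at the corners cover the
  rectangle; the alternatives in \<open>diag\<close> express that opposite triangles do not overlap, which is the girth bound.
\<close>
locale covered_cell =
  fixes a b p00 p10 p01 p11 :: real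
  assumes a_pos: "0 < a" and b_pos: "0 < b"
    and nonneg: "0 \<le> p00" "0 \<le> p10" "0 \<le> p01" "0 \<le> p11"
    and bottom: "p00 + p10 = a \<or> p10 = p00 + a \<or> p00 = p10 + a"
    and top: "p01 + p11 = a \<or> p11 = p01 + a \<or> p01 = p11 + a"
    and left: "p00 + p01 = b \<or> p01 = p00 + b \<or> p00 = p01 + b"
    and right: "p10 + p11 = b \<or> p11 = p10 + b \<or> p10 = p11 + b"
    and diag: "p00 + p11 \<le> a + b \<or> p10 = p00 + a \<or> p01 = p11 + a"
      "p00 + p11 \<le> a + b \<or> p01 = p00 + b \<or> p10 = p11 + b"
      "p10 + p01 \<le> a + b \<or> p00 = p10 + a \<or> p11 = p01 + a"
      "p10 + p01 \<le> a + b \<or> p00 = p01 + b \<or> p11 = p10 + b"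
    and cover: "\<And>x y. x \<in> {0..a} \<Longrightarrow> y \<in> {0..b} \<Longrightarrow>
      x + y \<le> p00 \<or> (a - x) + y \<le> p10 \<or> x + (b - y) \<le> p01 \<or> (a - x) + (b - y) \<le> p11"
begin

lemma flip_x: "covered_cell a b p10 p00 p11 p01"
proof
  fix x y assume "x \<in> {0..a}" "y \<in> {0..b}"
  with cover[of "a - x" y]
  show "x + y \<le> p10 \<or> (a - x) + y \<le> p00 \<or> x + (b - y) \<le> p11 \<or> (a - x) + (b - y) \<le> p01"
    by auto
qed (use a_pos b_pos nonneg bottom top left right diag in \<open>simp_all only: ac_simps\<close>)

lemma flip_y: "covered_cell a b p01 p11 p00 p10"
proof
  fix x y assume "x \<in> {0..a}" "y \<in> {0..b}"
  with cover[of x "b - y"]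
  show "x + y \<le> p01 \<or> (a - x) + y \<le> p11 \<or> x + (b - y) \<le> p00 \<or> (a - x) + (b - y) \<le> p10"
    by auto
qed (use a_pos b_pos nonneg bottom top left right diag in \<open>simp_all only: ac_simps\<close>)

lemma transpose: "covered_cell b a p00 p01 p10 p11"
proof
  fix x y assume "x \<in> {0..b}" "y \<in> {0..a}"
  with cover[of y x]
  show "x + y \<le> p00 \<or> (b - x) + y \<le> p01 \<or> x + (a - y) \<le> p10 \<or> (b - x) + (a - y) \<le> p11"
    by auto
qed (use a_pos b_pos nonneg bottom top left right diag in \<open>simp_all only: ac_simps\<close>)

text \<open>Just above the common end of two triangles that meet on the bottom side, a third one is needed.\<close>
lemma wedge:
  assumes "p00 + p10 = a" "0 < p00" "0 < p10"
  shows "p11 = p10 + b \<or> p01 = p00 + b"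
proof (rule ccontr)
  assume "\<not> ?thesis"
  then have lt: "p11 < p10 + b" "p01 < p00 + b"
    using left right nonneg b_pos by auto
  \<comment> \<open>The point \<open>(p00, y)\<close> with \<open>y > 0\<close> lies outside both
    bottom triangles; half of the slack keeps it outside both top ones.\<close>
  define y where "y = Min {b, (p10 + b - p11) / 2, (p00 + b - p01) / 2}"
  have y: "0 < y" "y \<le> b" "y \<le> (p10 + b - p11) / 2" "y \<le> (p00 + b - p01) / 2"
    using lt b_pos by (auto simp: y_def min_def)
  have "p00 \<in> {0..a}" "y \<in> {0..b}" using y assms by auto
  from cover[OF this] show False using y assms lt by (auto simp: field_simps)
qed

text \<open>The triangle at a largest corner is nested in no neighbouring one, so its sign is
  \<open>+1\<close>. How it meets the bottom and left sides leaves four shapes; in each of them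
  \<open>diag\<close> or \<open>wedge\<close> fixes \<open>p11\<close>, and a polynomial identity
  remains.\<close>

lemma quadratic_identity_max:
  assumes "Modules.additive \<phi>" and max: "p10 \<le> p00" "p01 \<le> p00" "p11 \<le> p00"
  shows "2 * \<phi> a * \<phi> b =
    side_sign a p00 p10 * side_sign b p00 p01 * (\<phi> p00)\<^sup>2 +
    side_sign a p10 p00 * side_sign b p10 p11 * (\<phi> p10)\<^sup>2 +
    side_sign a p01 p11 * side_sign b p01 p00 * (\<phi> p01)\<^sup>2 +
    side_sign a p11 p01 * side_sign b p11 p10 * (\<phi> p11)\<^sup>2"
    (is "_ = ?T00 + ?T10 + ?T01 + ?T11")
proof -
  interpret Modules.additive \<phi> by fact
  note pos = a_pos b_pos nonneg
  have T00: "?T00 = (\<phi> p00)\<^sup>2"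
    using max pos by (simp add: side_sign_def)
  consider (both) "p00 = p10 + a" "p00 = p01 + b" | (x) "p00 = p10 + a" "p00 + p01 = b" "0 < p01"
    | (y) "p00 + p10 = a" "p00 = p01 + b" "0 < p10" | (none) "p00 + p10 = a" "p00 + p01 = b"
    using bottom left max pos by (smt (verit))
  then show ?thesis
  proof cases
    case both
    show ?thesis
    \<comment> \<open>Either all other triangles are nested in the largest one, or those at the
      opposite corners \<open>00\<close> and \<open>11\<close> share the line of their
      hypotenuses.\<close>
    proof (cases "p11 = p00 - a - b")
      case True
      have T: "?T10 = - (\<phi> p10)\<^sup>2" "?T01 = - (\<phi> p01)\<^sup>2" "?T11 = (\<phi> p11)\<^sup>2"
        using True both pos by (simp_all add: side_sign_def)
      have p: "p10 = p00 - a" "p01 = p00 - b" using both by auto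
      have "\<phi> p10 = \<phi> p00 - \<phi> a" "\<phi> p01 = \<phi> p00 - \<phi> b" "\<phi> p11 = \<phi> p00 - \<phi> a - \<phi> b"
        by (simp_all only: p True diff add)
      then show ?thesis
        unfolding T00 T by (simp only:) (simp add: power2_eq_square algebra_simps)
    next
      case False
      have eq: "p11 = a + b - p00"
        using False both right top diag pos by (smt (verit))
      \<comment> \<open>At \<open>p10 = 0\<close> the second sign changes, but the term vanishes
        because \<open>\<phi> 0 = 0\<close>.\<close>
      have T10: "?T10 = - (\<phi> p10)\<^sup>2"
        using eq both pos by (cases "p10 = 0") (auto simp: side_sign_def zero)
      have T01: "?T01 = - (\<phi> p01)\<^sup>2"
        using eq both pos by (cases "p01 = 0") (auto simp: side_sign_def zero)
      have T11: "?T11 = (\<phi> p11)\<^sup>2"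
        using eq both pos by (cases "p11 = 0") (auto simp: side_sign_def zero)
      have p: "p10 = p00 - a" "p01 = p00 - b" using both by auto
      have "\<phi> p10 = \<phi> p00 - \<phi> a" "\<phi> p01 = \<phi> p00 - \<phi> b" "\<phi> p11 = \<phi> a + \<phi> b - \<phi> p00"
        by (simp_all only: eq p diff add)
      then show ?thesis
        unfolding T00 T10 T01 T11 by (simp only:) (simp add: power2_eq_square algebra_simps)
    qed
  next
    case x
    have eq: "p11 = p01 + a"
    proof (cases "p00 = 0")
      case True
      then show ?thesis using x max pos top right by (smt (verit))
    next
      case False
      then show ?thesis
        using covered_cell.wedge[OF transpose] x pos False by (smt (verit))
    qed
    have T10: "?T10 = - (\<phi> p10)\<^sup>2"
      using eq x pos by (cases "p10 = 0") (auto simp: side_sign_def zero)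
    have T01: "?T01 = - (\<phi> p01)\<^sup>2"
      using eq x pos by (cases "p01 = 0") (auto simp: side_sign_def zero)
    have T11: "?T11 = (\<phi> p11)\<^sup>2"
      using eq x pos by (cases "p11 = 0") (auto simp: side_sign_def zero)
    have p: "p10 = p00 - a" "p01 = b - p00" using x by auto
    have "\<phi> p10 = \<phi> p00 - \<phi> a" "\<phi> p01 = \<phi> b - \<phi> p00" "\<phi> p11 = \<phi> b - \<phi> p00 + \<phi> a"
      by (simp_all only: eq p diff add)
    then show ?thesis
      unfolding T00 T10 T01 T11 by (simp only:) (simp add: power2_eq_square algebra_simps)
  next
    case y
    have eq: "p11 = p10 + b"
    proof (cases "p00 = 0")
      case True
      then show ?thesis using y max pos top right by (smt (verit))
    next
      case False
      then show ?thesis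
        using wedge y pos False by (smt (verit))
    qed
    have T10: "?T10 = - (\<phi> p10)\<^sup>2"
      using eq y pos by (cases "p10 = 0") (auto simp: side_sign_def zero)
    have T01: "?T01 = - (\<phi> p01)\<^sup>2"
      using eq y pos by (cases "p01 = 0") (auto simp: side_sign_def zero)
    have T11: "?T11 = (\<phi> p11)\<^sup>2"
      using eq y pos by (cases "p11 = 0") (auto simp: side_sign_def zero)
    have p: "p01 = p00 - b" "p10 = a - p00" using y by auto
    have "\<phi> p01 = \<phi> p00 - \<phi> b" "\<phi> p10 = \<phi> a - \<phi> p00" "\<phi> p11 = \<phi> a - \<phi> p00 + \<phi> b"
      by (simp_all only: eq p diff add)
    then show ?thesis
      unfolding T00 T10 T01 T11 by (simp only:) (simp add: power2_eq_square algebra_simps)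
  next
    case none
    have "0 < p00" using none max pos by linarith
    then have "p10 = 0 \<or> p11 = p10 + b \<or> p01 = p00 + b"
      using wedge none pos \<open>0 < p00\<close> by (smt (verit))
    moreover have "p01 = 0 \<or> p11 = p01 + a \<or> p10 = p00 + a"
      using covered_cell.wedge[OF transpose] none pos \<open>0 < p00\<close> by (smt (verit))
    \<comment> \<open>As no corner exceeds \<open>p00\<close>, only a square halved by its diagonal
      remains.\<close>
    ultimately have eq: "p10 = 0" "p01 = 0" "a = p00" "b = p00" "p11 = p00"
      using none max pos top right by (smt (verit))+
    have "?T11 = (\<phi> p11)\<^sup>2"
      using eq pos by (simp add: side_sign_def)
    then show ?thesis
      unfolding T00 using eq by (simp add: zero power2_eq_square)
  qed
qed

text \<open>
  For \<open>\<phi> = id\<close> this computes the area of the rectangle from the corner triangles, a triangle nested in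
  another one being subtracted where the larger one leaves the rectangle.
\<close>
lemma quadratic_identity:
  assumes "Modules.additive \<phi>"
  shows "2 * \<phi> a * \<phi> b =
    side_sign a p00 p10 * side_sign b p00 p01 * (\<phi> p00)\<^sup>2 +
    side_sign a p10 p00 * side_sign b p10 p11 * (\<phi> p10)\<^sup>2 +
    side_sign a p01 p11 * side_sign b p01 p00 * (\<phi> p01)\<^sup>2 +
    side_sign a p11 p01 * side_sign b p11 p10 * (\<phi> p11)\<^sup>2"
proof -
  define M where "M = max (max p00 p10) (max p01 p11)"
  have M: "p00 \<le> M" "p10 \<le> M" "p01 \<le> M" "p11 \<le> M"
    by (auto simp: M_def)
  have "M = p00 \<or> M = p10 \<or> M = p01 \<or> M = p11"
    by (auto simp: M_def max_def)
  then consider "M = p00" | "M = p10" | "M = p01" | "M = p11"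
    by blast
  then show ?thesis
  proof cases
    case 1
    then show ?thesis using quadratic_identity_max[OF assms] M by simp
  next
    case 2
    show ?thesis
      by (subst covered_cell.quadratic_identity_max[OF flip_x assms])
        (use 2 M in \<open>simp_all only: ac_simps\<close>)
  next
    case 3
    show ?thesis
      by (subst covered_cell.quadratic_identity_max[OF flip_y assms])
        (use 3 M in \<open>simp_all only: ac_simps\<close>)
  next
    case 4
    show ?thesis
      by (subst covered_cell.quadratic_identity_max[OF covered_cell.flip_x[OF flip_y] assms])
        (use 4 M in \<open>simp_all only: ac_simps\<close>)
  qed
qed

end

section \<open>The quadratic form of turns\<close>

text \<open>The value \<open>p u v\<close> stands for \<open>pi\<close> minus the distance of \<open>u\<close> and \<open>v\<close>.\<close>
locale taut_graph =
  fixes H :: "'e set" and tl :: "'e \<Rightarrow> 'v" and rev :: "'e \<Rightarrow> 'e" and len :: "'e \<Rightarrow> real"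
    and p :: "'v \<Rightarrow> 'v \<Rightarrow> real"
  assumes finite_H: "finite H"
    and rev_in: "e \<in> H \<Longrightarrow> rev e \<in> H"
    and rev_rev: "e \<in> H \<Longrightarrow> rev (rev e) = e"
    and rev_neq: "e \<in> H \<Longrightarrow> rev e \<noteq> e"
    and len_pos: "e \<in> H \<Longrightarrow> 0 < len e"
    and len_rev: "e \<in> H \<Longrightarrow> len (rev e) = len e"
    and p_nonneg: "e \<in> H \<Longrightarrow> f \<in> H \<Longrightarrow> 0 \<le> p (tl e) (tl f)"
    and p_sym: "e \<in> H \<Longrightarrow> f \<in> H \<Longrightarrow> p (tl e) (tl f) = p (tl f) (tl e)"
    and p_refl: "e \<in> H \<Longrightarrow> p (tl e) (tl e) = pi"
    and p_edge: "e \<in> H \<Longrightarrow> p (tl e) (tl (rev e)) = \<bar>pi - len e\<bar>"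
    and branch: "\<lbrakk>e \<in> H; e' \<in> H; e \<noteq> e'; tl e = tl e'; f \<in> H; 0 < p (tl e) (tl f);
      p (tl (rev e)) (tl f) = p (tl e) (tl f) + len e\<rbrakk> \<Longrightarrow>
      p (tl (rev e')) (tl f) \<noteq> p (tl e) (tl f) + len e'"
    and cell: "\<lbrakk>e \<in> H; f \<in> H; f \<noteq> e; f \<noteq> rev e\<rbrakk> \<Longrightarrow>
      covered_cell (len e) (len f) (p (tl e) (tl f)) (p (tl (rev e)) (tl f))
        (p (tl e) (tl (rev f))) (p (tl (rev e)) (tl (rev f)))"
begin

text \<open>With \<open>p\<close> being \<open>pi\<close> minus the distance, this is the initial
  slope along \<open>g\<close> of the distance to \<open>y\<close>.\<close>

definition dir_sign :: "'e \<Rightarrow> 'v \<Rightarrow> real" where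
  "dir_sign g y = side_sign (len g) (p (tl g) y) (p (tl (rev g)) y)"

definition corner :: "(real \<Rightarrow> real) \<Rightarrow> 'e \<Rightarrow> 'e \<Rightarrow> real" where
  "corner \<phi> g h = dir_sign g (tl h) * dir_sign h (tl g) * (\<phi> (p (tl g) (tl h)))\<^sup>2"

definition corners :: "(real \<Rightarrow> real) \<Rightarrow> 'e \<Rightarrow> 'e \<Rightarrow> real" where
  "corners \<phi> e f = corner \<phi> e f + corner \<phi> (rev e) f + corner \<phi> e (rev f) + corner \<phi> (rev e) (rev f)"

lemma corners_distinct:
  assumes "Modules.additive \<phi>" "e \<in> H" "f \<in> H" "f \<noteq> e" "f \<noteq> rev e"
  shows "2 * \<phi> (len e) * \<phi> (len f) = corners \<phi> e f"
  using covered_cell.quadratic_identity[OF cell[OF assms(2-5)] assms(1)] assms(2,3)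
  by (simp add: corners_def corner_def dir_sign_def rev_rev rev_in len_rev
      p_sym[of f] p_sym[of "rev f"])

text \<open>The square of an edge with itself is not a \<open>covered_cell\<close>. Its two corners
  on the diagonal contribute \<open>(\<phi> pi)\<^sup>2\<close> each, the other two
  \<open>(\<phi> pi - \<phi> (len e))\<^sup>2\<close> each, since their two signs agree; the extra
  term is the defect.\<close>

lemma corners_same:
  assumes "Modules.additive \<phi>" "e \<in> H"
  shows "2 * \<phi> (len e) * \<phi> (len e) = corners \<phi> e e + 4 * \<phi> pi * (\<phi> (len e) - \<phi> pi)"
proof -
  interpret Modules.additive \<phi> by fact
  have "0 < len e" using assms len_pos by auto
  have sq: "(\<phi> \<bar>pi - len e\<bar>)\<^sup>2 = (\<phi> pi - \<phi> (len e))\<^sup>2"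
    by (auto simp: abs_if minus diff power2_eq_square algebra_simps)
  have "side_sign (len e) pi \<bar>pi - len e\<bar> = 1"
    using \<open>0 < len e\<close> pi_gt_zero by (auto simp: side_sign_def abs_if)
  then have "corner \<phi> e e = (\<phi> pi)\<^sup>2" "corner \<phi> (rev e) (rev e) = (\<phi> pi)\<^sup>2"
    using assms p_edge[of e] p_edge[of "rev e"]
    by (simp_all add: corner_def dir_sign_def p_refl rev_in p_sym[of "rev e" e] rev_rev len_rev)
  moreover have "side_sign (len e) \<bar>pi - len e\<bar> pi * side_sign (len e) \<bar>pi - len e\<bar> pi = 1"
    by (simp add: side_sign_def)
  then have "corner \<phi> (rev e) e = (\<phi> pi - \<phi> (len e))\<^sup>2"
    "corner \<phi> e (rev e) = (\<phi> pi - \<phi> (len e))\<^sup>2"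
    using assms p_edge[of e] sq
    by (simp_all add: corner_def dir_sign_def p_refl rev_in p_sym[of "rev e" e] rev_rev len_rev)
  ultimately show ?thesis
    by (simp add: corners_def power2_eq_square algebra_simps)
qed

lemma corners_rev:
  assumes "f \<in> H"
  shows "corners \<phi> e (rev f) = corners \<phi> e f"
  using assms by (simp add: corners_def rev_rev)

lemma two_edges:
  assumes "Modules.additive \<phi>" "e \<in> H" "f \<in> H"
  shows "2 * \<phi> (len e) * \<phi> (len f) = corners \<phi> e f +
    (if f = e then 4 * \<phi> pi * (\<phi> (len e) - \<phi> pi) else 0) +
    (if f = rev e then 4 * \<phi> pi * (\<phi> (len e) - \<phi> pi) else 0)"
  using corners_distinct[OF assms] corners_same[OF assms(1,2)] assms rev_neq[of e]
  by (auto simp: corners_rev len_rev)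

section \<open>Weighted systems of turns and the product formula\<close>

definition mass :: "('e \<Rightarrow> 'e \<Rightarrow> real) \<Rightarrow> 'e \<Rightarrow> real" where
  "mass w g = (\<Sum>h\<in>H. w g h)"

text \<open>
  A weighted system of turns \<open>w\<close> generalises a closed walk without backtracking: \<open>w g h\<close> counts the
  passages through a vertex that use the directions \<open>g\<close> and \<open>h\<close> there, regardless of the order.
\<close>
definition current :: "('e \<Rightarrow> 'e \<Rightarrow> real) \<Rightarrow> bool" where
  "current w \<longleftrightarrow> (\<forall>g\<in>H. \<forall>h\<in>H. 0 \<le> w g h \<and> w g h = w h g \<and> (w g h \<noteq> 0 \<longrightarrow> g \<noteq> h \<and> tl g = tl h)) \<and>
    (\<forall>g\<in>H. mass w (rev g) = mass w g)"

text \<open>Halved because \<open>H\<close> contains both orientations of each edge.\<close>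

definition current_length :: "(real \<Rightarrow> real) \<Rightarrow> ('e \<Rightarrow> 'e \<Rightarrow> real) \<Rightarrow> real" where
  "current_length \<phi> w = (\<Sum>e\<in>H. mass w e * \<phi> (len e)) / 2"

text \<open>For two turns at positive radius each factor is 0 or 2, and it is 2 where the distance
  increases in both directions of the turn. Two such turns thus give \<open>1/2\<close>, and their
  four orderings produce the factor 2 before the sum of squares. At radius 0 \<open>branch\<close>
  gives no control of the signs.\<close>

definition crossing :: "'e \<times> 'e \<times> 'e \<times> 'e \<Rightarrow> real" where
  "crossing = (\<lambda>(g, g', h, h'). if p (tl g) (tl h) = 0 then 0 else
     (dir_sign g (tl h) + dir_sign g' (tl h)) * (dir_sign h (tl g) + dir_sign h' (tl g)) / 8)"

definition weight :: "('e \<Rightarrow> 'e \<Rightarrow> real) \<Rightarrow> ('e \<Rightarrow> 'e \<Rightarrow> real) \<Rightarrow> 'e \<times> 'e \<times> 'e \<times> 'e \<Rightarrow> real" where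
  "weight v w = (\<lambda>(g, g', h, h'). v g g' * w h h' * crossing (g, g', h, h'))"

definition radius :: "'e \<times> 'e \<times> 'e \<times> 'e \<Rightarrow> real" where
  "radius = (\<lambda>(g, g', h, h'). p (tl g) (tl h))"

text \<open>Two slopes \<open>-1\<close> would mean two geodesics to \<open>tl f\<close> with
  different initial edges, which \<open>branch\<close> forbids at distances below
  \<open>pi\<close>.\<close>

lemma dir_sign_sum_nonneg:
  assumes "g \<in> H" "g' \<in> H" "g \<noteq> g'" "tl g = tl g'" "f \<in> H" "0 < p (tl g) (tl f)"
  shows "0 \<le> dir_sign g (tl f) + dir_sign g' (tl f)"
  using branch[OF assms] assms(4) by (auto simp: dir_sign_def side_sign_def)

lemma weight_nonneg:
  assumes "current v" "current w" "i \<in> H \<times> H \<times> H \<times> H"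
  shows "0 \<le> weight v w i"
proof -
  obtain g g' h h' where i: "i = (g, g', h, h')" and H: "g \<in> H" "g' \<in> H" "h \<in> H" "h' \<in> H"
    using assms(3) by auto
  show ?thesis
  proof (cases "v g g' = 0 \<or> w h h' = 0 \<or> p (tl g) (tl h) = 0")
    case True
    then show ?thesis by (auto simp: i weight_def crossing_def)
  next
    case False
    then have "g \<noteq> g'" "tl g = tl g'" "h \<noteq> h'" "tl h = tl h'" "0 \<le> v g g'" "0 \<le> w h h'"
      using assms H unfolding current_def by blast+
    moreover have "0 < p (tl g) (tl h)" "0 < p (tl h) (tl g)"
      using False p_nonneg[of g h] p_sym[of g h] H by auto
    ultimately show ?thesis
      using dir_sign_sum_nonneg[of g g' h] dir_sign_sum_nonneg[of h h' g] H
      by (auto simp: i weight_def crossing_def)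
  qed
qed

lemma sum_rev: "(\<Sum>e\<in>H. F (rev e)) = (\<Sum>e\<in>H. F e)"
  by (rule sum.reindex_bij_witness[of _ rev rev]) (auto simp: rev_rev rev_in)

lemma sum_turns:
  assumes "current w"
  shows "(\<Sum>g\<in>H. \<Sum>h\<in>H. w g h * (X g + X h)) = 2 * (\<Sum>g\<in>H. mass w g * X g)"
proof -
  have "(\<Sum>g\<in>H. \<Sum>h\<in>H. w g h * X h) = (\<Sum>h\<in>H. \<Sum>g\<in>H. w h g * X h)"
    using assms by (subst sum.swap) (auto simp: current_def intro!: sum.cong)
  then show ?thesis
    by (simp add: distrib_left sum.distrib mass_def sum_distrib_right)
qed

text \<open>Masses are invariant under \<open>rev\<close>, so reversing \<open>e\<close> or
  \<open>f\<close> turns the sums over the four corners into one another.\<close>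

lemma sum_corners:
  assumes "current v" "current w"
  shows "(\<Sum>e\<in>H. \<Sum>f\<in>H. mass v e * mass w f * corners \<phi> e f) =
    4 * (\<Sum>e\<in>H. \<Sum>f\<in>H. mass v e * mass w f * corner \<phi> e f)"
proof -
  have w: "(\<Sum>f\<in>H. mass w f * X (rev f)) = (\<Sum>f\<in>H. mass w f * X f)" for X
    using sum_rev[of "\<lambda>f. mass w f * X f"] assms by (simp add: current_def)
  have v: "(\<Sum>f\<in>H. mass v f * X (rev f)) = (\<Sum>f\<in>H. mass v f * X f)" for X
    using sum_rev[of "\<lambda>f. mass v f * X f"] assms by (simp add: current_def)
  have "(\<Sum>e\<in>H. \<Sum>f\<in>H. mass v e * mass w f * corners \<phi> e f) =
    (\<Sum>e\<in>H. mass v e * (\<Sum>f\<in>H. mass w f * corner \<phi> e f)) +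
    (\<Sum>e\<in>H. mass v e * (\<Sum>f\<in>H. mass w f * corner \<phi> (rev e) f)) +
    (\<Sum>e\<in>H. mass v e * (\<Sum>f\<in>H. mass w f * corner \<phi> e (rev f))) +
    (\<Sum>e\<in>H. mass v e * (\<Sum>f\<in>H. mass w f * corner \<phi> (rev e) (rev f)))"
    by (simp add: corners_def distrib_left sum.distrib sum_distrib_left mult.assoc)
  also have "\<dots> = 4 * (\<Sum>e\<in>H. mass v e * (\<Sum>f\<in>H. mass w f * corner \<phi> e f))"
    using v[of "\<lambda>e. \<Sum>f\<in>H. mass w f * corner \<phi> e f"] by (simp add: w)
  finally show ?thesis by (simp add: sum_distrib_left mult.assoc)
qed

text \<open>Applying \<open>sum_turns\<close> in both variables collects the four corners between
  two turns, whose signs factor into the product in \<open>crossing\<close>. Radius 0 is harmless as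
  \<open>\<phi> 0 = 0\<close>.\<close>

lemma sum_weights:
  assumes "current v" "current w" "\<phi> 0 = 0"
  shows "(\<Sum>e\<in>H. \<Sum>f\<in>H. mass v e * mass w f * corner \<phi> e f) =
    2 * (\<Sum>i\<in>H \<times> H \<times> H \<times> H. weight v w i * (\<phi> (radius i))\<^sup>2)"
proof -
  have eq: "v g g' * (w h h' * (corner \<phi> g h + corner \<phi> g' h + (corner \<phi> g h' + corner \<phi> g' h'))) =
      8 * (weight v w (g, g', h, h') * (\<phi> (radius (g, g', h, h')))\<^sup>2)"
    if "g \<in> H" "g' \<in> H" "h \<in> H" "h' \<in> H" for g g' h h'
  proof (cases "v g g' = 0 \<or> w h h' = 0")
    case True
    then show ?thesis by (auto simp: weight_def)
  next
    case False
    then have "tl g' = tl g" "tl h' = tl h"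
      using assms that unfolding current_def by metis+
    then show ?thesis
      by (simp add: weight_def crossing_def radius_def corner_def assms(3) algebra_simps)
  qed
  have "4 * (\<Sum>e\<in>H. \<Sum>f\<in>H. mass v e * mass w f * corner \<phi> e f) =
    2 * (\<Sum>g\<in>H. mass v g * (\<Sum>h\<in>H. \<Sum>h'\<in>H. w h h' * (corner \<phi> g h + corner \<phi> g h')))"
    by (simp add: sum_turns[OF assms(2)] sum_distrib_left mult.assoc mult.left_commute)
  also have "\<dots> = (\<Sum>g\<in>H. \<Sum>g'\<in>H. v g g' *
      ((\<Sum>h\<in>H. \<Sum>h'\<in>H. w h h' * (corner \<phi> g h + corner \<phi> g h')) +
       (\<Sum>h\<in>H. \<Sum>h'\<in>H. w h h' * (corner \<phi> g' h + corner \<phi> g' h'))))"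
    by (rule sum_turns[OF assms(1), symmetric])
  also have "\<dots> = (\<Sum>g\<in>H. \<Sum>g'\<in>H. \<Sum>h\<in>H. \<Sum>h'\<in>H.
      v g g' * (w h h' * (corner \<phi> g h + corner \<phi> g' h + (corner \<phi> g h' + corner \<phi> g' h'))))"
    by (simp add: sum.distrib[symmetric] sum_distrib_left algebra_simps)
  also have "\<dots> = (\<Sum>g\<in>H. \<Sum>g'\<in>H. \<Sum>h\<in>H. \<Sum>h'\<in>H.
      8 * (weight v w (g, g', h, h') * (\<phi> (radius (g, g', h, h')))\<^sup>2))"
    by (intro sum.cong refl eq)
  also have "\<dots> = 8 * (\<Sum>i\<in>H \<times> H \<times> H \<times> H. weight v w i * (\<phi> (radius i))\<^sup>2)"
    by (simp add: sum.cartesian_product sum_distrib_left split_def)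
  finally show ?thesis by simp
qed

text \<open>The product is expanded over pairs of edges, each pair is replaced by its corners
  through \<open>two_edges\<close>, and the corners are regrouped into pairs of turns. The last sum
  stems from the pairs with \<open>f = e\<close> or \<open>f = rev e\<close>.\<close>

theorem current_length_mult:
  assumes "Modules.additive \<phi>" "current v" "current w"
  shows "current_length \<phi> v * current_length \<phi> w =
    (\<Sum>i\<in>H \<times> H \<times> H \<times> H. weight v w i * (\<phi> (radius i))\<^sup>2) +
    \<phi> pi * (\<Sum>e\<in>H. mass v e * mass w e * (\<phi> (len e) - \<phi> pi))"
proof -
  interpret Modules.additive \<phi> by fact
  define c where "c e = 4 * \<phi> pi * (\<phi> (len e) - \<phi> pi)" for e
  have m: "mass w (rev e) = mass w e" if "e \<in> H" for e
    using assms(3) that by (simp add: current_def)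
  have "8 * (current_length \<phi> v * current_length \<phi> w) =
      (\<Sum>e\<in>H. \<Sum>f\<in>H. mass v e * mass w f * (2 * \<phi> (len e) * \<phi> (len f)))"
  proof -
    have "8 * (current_length \<phi> v * current_length \<phi> w) =
        2 * ((\<Sum>e\<in>H. mass v e * \<phi> (len e)) * (\<Sum>f\<in>H. mass w f * \<phi> (len f)))"
      by (simp add: current_length_def)
    also have "\<dots> = (\<Sum>e\<in>H. \<Sum>f\<in>H. 2 * ((mass v e * \<phi> (len e)) * (mass w f * \<phi> (len f))))"
      unfolding sum_product unfolding sum_distrib_left ..
    finally show ?thesis by (simp add: mult.assoc mult.left_commute)
  qed
  also have "\<dots> = (\<Sum>e\<in>H. \<Sum>f\<in>H. mass v e * mass w f * corners \<phi> e f +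
      ((if f = e then mass v e * mass w f * c e else 0) +
       (if f = rev e then mass v e * mass w f * c e else 0)))"
    using two_edges[OF assms(1)] by (intro sum.cong refl) (auto simp: c_def algebra_simps)
  also have "\<dots> = (\<Sum>e\<in>H. \<Sum>f\<in>H. mass v e * mass w f * corners \<phi> e f) +
      (\<Sum>e\<in>H. 2 * (mass v e * mass w e * c e))"
    by (simp add: sum.distrib finite_H rev_in m algebra_simps)
  finally have "8 * (current_length \<phi> v * current_length \<phi> w) = \<dots>" .
  moreover have *: "(\<Sum>e\<in>H. 2 * (mass v e * mass w e * c e)) =
      8 * (\<phi> pi * (\<Sum>e\<in>H. mass v e * mass w e * (\<phi> (len e) - \<phi> pi)))"
    by (simp add: c_def sum_distrib_left algebra_simps)
  ultimately show ?thesis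
    unfolding sum_corners[OF assms(2,3)] sum_weights[where \<phi> = \<phi>, OF assms(2,3) zero] *
    by simp
qed

end

section \<open>Flipping along a cycle\<close>

text \<open>Over the rationals, \<open>x\<close> and \<open>y\<close> are linearly independent
  reals, so any values on them extend to a linear map.\<close>

lemma additive_extension:
  fixes x y :: real
  assumes "y \<noteq> 0" and indep: "\<And>q. q \<in> \<rat> \<Longrightarrow> x \<noteq> q * y"
  obtains f :: "real \<Rightarrow> real" where "Modules.additive f" "\<And>q z. q \<in> \<rat> \<Longrightarrow> f (q * z) = q * f z"
    "f y = c" "f x = d"
proof -
  interpret Q: vector_space "\<lambda>(q::rat) (z::real). of_rat q * z"
    by standard (simp_all add: of_rat_add of_rat_mult algebra_simps)
  interpret QQ: vector_space_pair "\<lambda>(q::rat) (z::real). of_rat q * z" "\<lambda>(q::rat) (z::real). of_rat q * z"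
    by standard
  have "x \<notin> Q.span {y}"
  proof
    assume "x \<in> Q.span {y}"
    then obtain k where "x = of_rat k * y"
      unfolding Q.span_singleton by blast
    then show False using indep[of "of_rat k"] by simp
  qed
  moreover have "Q.independent {y}"
    using assms(1) by simp
  ultimately have "Q.independent {x, y}"
    by (simp add: Q.independent_insert)
  from QQ.linear_independent_extend[OF this, of "\<lambda>z. if z = y then c else d"]
  obtain f where lin: "Vector_Spaces.linear (\<lambda>(q::rat) (z::real). of_rat q * z) (\<lambda>(q::rat) (z::real). of_rat q * z) f"
    and f: "f x = (if x = y then c else d)" "f y = c"
    by auto
  interpret f: Vector_Spaces.linear "\<lambda>(q::rat) (z::real). of_rat q * z" "\<lambda>(q::rat) (z::real). of_rat q * z" f
    by (rule lin)
  have "Modules.additive f"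
    by standard (rule f.add)
  moreover have "f (q * z) = q * f z" if "q \<in> \<rat>" for q z
    using that f.scale by (auto elim: Rats_cases)
  moreover have "x \<noteq> y" using indep[of 1] by simp
  ultimately show thesis using that f by auto
qed

context taut_graph
begin

lemma current_length_id_scale:
  assumes "Modules.additive f" "\<And>q z. q \<in> \<rat> \<Longrightarrow> f (q * z) = q * f z"
    and "\<And>e. e \<in> H \<Longrightarrow> mass w e \<in> \<rat>"
  shows "f (current_length (\<lambda>x. x) w) = current_length f w"
proof -
  interpret Modules.additive f by fact
  have "current_length (\<lambda>x. x) w = (1/2) * (\<Sum>e\<in>H. mass w e * len e)" by (simp add: current_length_def)
  also have "f \<dots> = (1/2) * (\<Sum>e\<in>H. f (mass w e * len e))"
    by (subst assms(2)) (simp_all add: sum)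
  also have "\<dots> = current_length f w"
    using assms(2,3) by (simp add: current_length_def)
  finally show ?thesis .
qed

lemma mass_nonneg: "current w \<Longrightarrow> e \<in> H \<Longrightarrow> 0 \<le> mass w e"
  by (auto simp: mass_def current_def intro: sum_nonneg)

lemma current_length_mult_nonneg:
  assumes "Modules.additive \<phi>" "\<phi> pi = 0" "current v" "current w"
  shows "0 \<le> current_length \<phi> v * current_length \<phi> w"
proof -
  have "0 \<le> (\<Sum>i\<in>H \<times> H \<times> H \<times> H. weight v w i * (\<phi> (radius i))\<^sup>2)"
    by (intro sum_nonneg mult_nonneg_nonneg weight_nonneg assms) simp_all
  then show ?thesis
    using current_length_mult[OF assms(1,3,4)] assms(2) by simp
qed

text \<open>For \<open>f\<close> the product formula is a vanishing sum of nonnegative terms, so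
  \<open>f (radius i) = 0\<close> wherever the weight is nonzero. Hence the formulas for
  \<open>id\<close> and \<open>id + f\<close> have equal sums of squares, and their difference is
  the claim.\<close>

lemma current_length_null:
  assumes "Modules.additive f" "f pi = 0" "current v" "current w" "current_length f v = 0"
  shows "current_length (\<lambda>x. x) v * current_length f w = pi * (\<Sum>e\<in>H. mass v e * mass w e * f (len e))"
proof -
  interpret f: Modules.additive f by fact
  have idf: "Modules.additive (\<lambda>x. x + f x)" and id: "Modules.additive (\<lambda>x::real. x)"
    by standard (simp_all add: f.add)
  have "(\<Sum>i\<in>H \<times> H \<times> H \<times> H. weight v w i * (f (radius i))\<^sup>2) = 0"
    using current_length_mult[OF assms(1,3,4)] assms(2,5) by simp
  moreover have "finite (H \<times> H \<times> H \<times> H)"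
    using finite_H by simp
  ultimately have "weight v w i * (f (radius i))\<^sup>2 = 0" if "i \<in> H \<times> H \<times> H \<times> H" for i
    using weight_nonneg[OF assms(3,4)] that by (subst (asm) sum_nonneg_eq_0_iff) auto
  then have "(\<Sum>i\<in>H \<times> H \<times> H \<times> H. weight v w i * (radius i + f (radius i))\<^sup>2) =
      (\<Sum>i\<in>H \<times> H \<times> H \<times> H. weight v w i * (radius i)\<^sup>2)"
    by (intro sum.cong refl) fastforce
  moreover have "current_length (\<lambda>x. x + f x) u = current_length (\<lambda>x. x) u + current_length f u" for u
    by (simp add: current_length_def algebra_simps sum.distrib add_divide_distrib)
  ultimately have "current_length (\<lambda>x. x) v * (current_length (\<lambda>x. x) w + current_length f w) - current_length (\<lambda>x. x) v * current_length (\<lambda>x. x) w =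
    pi * (\<Sum>e\<in>H. mass v e * mass w e * (len e + f (len e) - pi)) -
    pi * (\<Sum>e\<in>H. mass v e * mass w e * (len e - pi))"
    using current_length_mult[OF idf assms(3,4)] current_length_mult[OF id assms(3,4)] assms(2,5)
    by simp
  also have "\<dots> = pi * (\<Sum>e\<in>H. mass v e * mass w e * f (len e))"
    unfolding right_diff_distrib[symmetric] sum_subtractf[symmetric]
    by (simp add: algebra_simps)
  finally show ?thesis by (simp add: algebra_simps)
qed

end

text \<open>\<open>A\<close> is a disjoint union of cycles; \<open>star\<close> exchanges the two directions of \<open>A\<close> at a vertex.\<close>
locale taut_graph_cycle = taut_graph +
  fixes A :: "'a set" and star :: "'a \<Rightarrow> 'a"
  assumes A_subset: "A \<subseteq> H" and A_nonempty: "A \<noteq> {}"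
    and rev_A: "g \<in> A \<Longrightarrow> rev g \<in> A"
    and star_A: "g \<in> A \<Longrightarrow> star g \<in> A"
    and star_neq: "g \<in> A \<Longrightarrow> star g \<noteq> g"
    and tl_star: "g \<in> A \<Longrightarrow> tl (star g) = tl g"
    and star_unique: "g \<in> A \<Longrightarrow> h \<in> A \<Longrightarrow> tl h = tl g \<Longrightarrow> h = g \<or> h = star g"
begin

lemma in_H: "g \<in> A \<Longrightarrow> g \<in> H"
  using A_subset by auto

lemma finite_A: "finite A"
  using A_subset finite_H finite_subset by auto

lemma star_star: "g \<in> A \<Longrightarrow> star (star g) = g"
  using star_unique[of "star g" g] star_A star_neq tl_star by force

lemma rev_A_iff: "g \<in> H \<Longrightarrow> rev g \<in> A \<longleftrightarrow> g \<in> A"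
  using rev_A[of g] rev_A[of "rev g"] rev_rev by auto

definition cyc :: "'a \<Rightarrow> 'a \<Rightarrow> real" where
  "cyc g h = (if g \<in> A \<and> h = star g then 1 else 0)"

lemma mass_cyc: "g \<in> H \<Longrightarrow> mass cyc g = (if g \<in> A then 1 else 0)"
  using finite_H in_H[OF star_A] by (auto simp: mass_def cyc_def)

lemma current_cyc: "current cyc"
proof -
  have "cyc g h = cyc h g" for g h
    by (auto simp: cyc_def star_star star_A)
  moreover have "g \<noteq> h \<and> tl g = tl h" if "cyc g h \<noteq> 0" for g h
    using that star_neq[of g] tl_star[of g] by (auto simp: cyc_def split: if_splits)
  moreover have "0 \<le> cyc g h" for g h
    by (simp add: cyc_def)
  ultimately show ?thesis
    unfolding current_def by (simp add: mass_cyc rev_in rev_A_iff)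
qed

lemma current_length_cyc: "current_length \<phi> cyc = (\<Sum>e\<in>A. \<phi> (len e)) / 2"
proof -
  have "(\<Sum>e\<in>H. mass cyc e * \<phi> (len e)) = (\<Sum>e\<in>H. if e \<in> A then \<phi> (len e) else 0)"
    by (intro sum.cong) (auto simp: mass_cyc)
  also have "\<dots> = (\<Sum>e\<in>A. \<phi> (len e))"
    using A_subset finite_H by (simp add: sum.If_cases Int_absorb1 Int_def[symmetric])
  finally show ?thesis by (simp add: current_length_def)
qed

lemma current_length_cyc_pos: "0 < current_length (\<lambda>x. x) cyc"
  using A_nonempty finite_A by (auto simp: current_length_cyc intro!: sum_pos len_pos in_H)

lemma dir_sign_self: "g \<in> H \<Longrightarrow> dir_sign g (tl g) = 1"
  using p_edge[of g] p_edge[of "rev g"] len_pos[of g] pi_gt_zero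
  by (auto simp: dir_sign_def side_sign_def p_refl rev_in rev_rev len_rev p_sym[of "rev g" g] abs_if split: if_splits)

text \<open>Only the turns at coinciding vertices are kept: two quadruples for each element of
  \<open>A\<close>, of weight \<open>1/2\<close> and radius \<open>pi\<close>. They cancel the
  \<open>(\<phi> pi)\<^sup>2\<close> subtracted in the sum over edges; the terms dropped are
  nonnegative.\<close>

lemma current_length_cyc_quadratic:
  assumes "Modules.additive \<phi>"
  shows "2 * \<phi> pi * current_length \<phi> cyc \<le> (current_length \<phi> cyc)\<^sup>2"
proof -
  let ?Q = "H \<times> H \<times> H \<times> H" and ?F = "\<lambda>i. weight cyc cyc i * (\<phi> (radius i))\<^sup>2"
  let ?a = "\<lambda>g. (g, star g, g, star g)" and ?b = "\<lambda>g. (g, star g, star g, g)"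
  have w: "?F (?a g) = (\<phi> pi)\<^sup>2 / 2" "?F (?b g) = (\<phi> pi)\<^sup>2 / 2" if "g \<in> A" for g
    using that dir_sign_self[of g] dir_sign_self[of "star g"]
    by (simp_all add: weight_def crossing_def radius_def cyc_def star_star star_A tl_star p_refl in_H)
  have "real (card A) * (\<phi> pi)\<^sup>2 = (\<Sum>g\<in>A. ?F (?a g)) + (\<Sum>g\<in>A. ?F (?b g))"
    by (simp only: w cong: sum.cong) simp
  also have "\<dots> = (\<Sum>i\<in>?a ` A. ?F i) + (\<Sum>i\<in>?b ` A. ?F i)"
    by (simp add: sum.reindex inj_on_def)
  also have "\<dots> = (\<Sum>i\<in>?a ` A \<union> ?b ` A. ?F i)"
    by (rule sum.union_disjoint[symmetric]) (use finite_A star_neq in auto)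
  also have "\<dots> \<le> (\<Sum>i\<in>?Q. ?F i)"
    by (rule sum_mono2) (auto simp: finite_H in_H star_A intro!: mult_nonneg_nonneg weight_nonneg current_cyc)
  finally have "real (card A) * (\<phi> pi)\<^sup>2 + \<phi> pi * (\<Sum>e\<in>H. mass cyc e * mass cyc e * (\<phi> (len e) - \<phi> pi))
      \<le> (current_length \<phi> cyc)\<^sup>2"
    using current_length_mult[OF assms current_cyc current_cyc] by (simp add: power2_eq_square)
  moreover have "(\<Sum>e\<in>H. mass cyc e * mass cyc e * (\<phi> (len e) - \<phi> pi)) =
      (\<Sum>e\<in>H. if e \<in> A then \<phi> (len e) - \<phi> pi else 0)"
    by (intro sum.cong) (auto simp: mass_cyc)
  moreover have "\<dots> = 2 * current_length \<phi> cyc - real (card A) * \<phi> pi"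
    using A_subset finite_H
    by (simp add: sum.If_cases Int_absorb1 Int_def[symmetric] current_length_cyc sum_subtractf)
  ultimately have "real (card A) * (\<phi> pi)\<^sup>2 + \<phi> pi * (2 * current_length \<phi> cyc - real (card A) * \<phi> pi)
      \<le> (current_length \<phi> cyc)\<^sup>2"
    by simp
  then show ?thesis
    by (simp add: right_diff_distrib power2_eq_square)
qed

lemma current_length_cyc_rational:
  obtains q where "q \<in> \<rat>" "current_length (\<lambda>x. x) cyc = q * pi"
proof (rule ccontr)
  assume "\<not> thesis"
  then have "\<And>q. q \<in> \<rat> \<Longrightarrow> current_length (\<lambda>x. x) cyc \<noteq> q * pi"
    using that by auto
  from additive_extension[OF _ this, of 1 1] obtain \<phi> where
    \<phi>: "Modules.additive \<phi>" "\<And>q z. q \<in> \<rat> \<Longrightarrow> \<phi> (q * z) = q * \<phi> z" "\<phi> pi = 1"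
      "\<phi> (current_length (\<lambda>x. x) cyc) = 1"
    by auto
  have "current_length \<phi> cyc = 1"
    using current_length_id_scale[OF \<phi>(1,2), of cyc] \<phi>(4) by (auto simp: mass_cyc)
  then show False
    using current_length_cyc_quadratic[OF \<phi>(1)] \<phi>(3) by simp
qed

text \<open>
  Every passage along \<open>A\<close> is replaced by the complementary one; adding \<open>A\<close> itself \<open>M\<close> times
  keeps the weights nonnegative.
\<close>
definition flip :: "('a \<Rightarrow> 'a \<Rightarrow> real) \<Rightarrow> real \<Rightarrow> 'a \<Rightarrow> 'a \<Rightarrow> real" where
  "flip w M g h =
    (if g \<in> A then if h \<in> A then if h = star g then M - mass w g - mass w h + w g h else 0
       else w (star g) h
     else if h \<in> A then w g (star h) else w g h)"

lemma sum_star: "(\<Sum>h\<in>A. F (star h)) = (\<Sum>h\<in>A. F h)"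
  by (rule sum.reindex_bij_witness[of _ star star]) (auto simp: star_star star_A)

lemma sum_H_split: "(\<Sum>h\<in>H. F h) = (\<Sum>h\<in>A. F h) + (\<Sum>h\<in>H - A. F h)"
  using sum.subset_diff[OF A_subset finite_H, of F] by (simp add: add.commute)

text \<open>For \<open>g\<close> in \<open>A\<close>, \<open>flip\<close> subtracts from
  \<open>M\<close> the number of passages using \<open>g\<close> or \<open>star g\<close>, which is
  \<open>mass w g + mass w (star g) - w g (star g)\<close>. The passages that leave \<open>A\<close>
  at \<open>star g\<close> are moved to \<open>g\<close> and give back
  \<open>mass w (star g) - w g (star g)\<close>.\<close>

lemma mass_flip:
  assumes "current w" "g \<in> H"
  shows "mass (flip w M) g = (if g \<in> A then M - mass w g else mass w g)"
proof (cases "g \<in> A")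
  case True
  have "(\<Sum>h\<in>A. w (star g) h) = (\<Sum>h\<in>A. if h = g then w g (star g) else 0)"
  proof (intro sum.cong refl)
    fix h assume h: "h \<in> A"
    have "w (star g) h = 0" if "h \<noteq> g"
    proof (rule ccontr)
      assume "w (star g) h \<noteq> 0"
      then have "star g \<noteq> h \<and> tl (star g) = tl h"
        using assms(1) h True unfolding current_def by (metis in_H star_A)
      then show False using star_unique[OF True h] tl_star[OF True] that by auto
    qed
    moreover have "w (star g) g = w g (star g)"
      using assms(1) True unfolding current_def by (metis in_H star_A)
    ultimately show "w (star g) h = (if h = g then w g (star g) else 0)" by auto
  qed
  then have "mass w (star g) = w g (star g) + (\<Sum>h\<in>H - A. w (star g) h)"
    using True finite_A by (simp add: mass_def sum_H_split)
  moreover have "(\<Sum>h\<in>A. flip w M g h) = M - mass w g - mass w (star g) + w g (star g)"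
    using True finite_A by (simp add: flip_def star_A)
  moreover have "(\<Sum>h\<in>H - A. flip w M g h) = (\<Sum>h\<in>H - A. w (star g) h)"
    using True by (intro sum.cong) (auto simp: flip_def)
  ultimately show ?thesis
    using True unfolding mass_def[of "flip w M" g] sum_H_split by simp
next
  case False
  then show ?thesis
    by (simp add: mass_def sum_H_split flip_def sum_star)
qed

lemma current_flip:
  assumes w: "current w" and M: "2 * (\<Sum>e\<in>H. mass w e) \<le> M"
  shows "current (flip w M)"
proof -
  have wD: "0 \<le> w g h" "w g h = w h g" "w g h \<noteq> 0 \<Longrightarrow> g \<noteq> h \<and> tl g = tl h"
    if "g \<in> H" "h \<in> H" for g h
    using w that unfolding current_def by blast+
  \<comment> \<open>Hence \<open>M\<close> exceeds the sum of any two masses, and the entries of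
    \<open>flip\<close> inside \<open>A\<close> are nonnegative.\<close>
  have le: "mass w g \<le> (\<Sum>e\<in>H. mass w e)" if "g \<in> H" for g
    using that by (intro member_le_sum mass_nonneg[OF w] finite_H) auto
  have "mass (flip w M) (rev g) = mass (flip w M) g" if "g \<in> H" for g
    using that w by (simp add: mass_flip rev_in rev_A_iff) (simp add: current_def)
  moreover have "0 \<le> flip w M g h" if "g \<in> H" "h \<in> H" for g h
    unfolding flip_def using that wD(1) le[of g] le[of h] M in_H[OF star_A] by fastforce
  moreover have "flip w M g h = flip w M h g" if "g \<in> H" "h \<in> H" for g h
  proof -
    have "h = star g \<longleftrightarrow> g = star h" if "g \<in> A" "h \<in> A"
      using that star_star by metis
    then show ?thesis
      unfolding flip_def using that wD(2) in_H[OF star_A] by simp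
  qed
  moreover have "g \<noteq> h \<and> tl g = tl h" if "g \<in> H" "h \<in> H" "flip w M g h \<noteq> 0" for g h
  proof (cases "g \<in> A"; cases "h \<in> A")
    assume "g \<in> A" "h \<in> A"
    then show ?thesis
      using that star_neq[of g] tl_star[of g] by (auto simp: flip_def split: if_splits)
  next
    assume "g \<in> A" "h \<notin> A"
    then show ?thesis
      using that wD(3)[of "star g" h] in_H[OF star_A, of g] tl_star[of g] by (auto simp: flip_def)
  next
    assume "g \<notin> A" "h \<in> A"
    then show ?thesis
      using that wD(3)[of g "star h"] in_H[OF star_A, of h] tl_star[of h] by (auto simp: flip_def)
  next
    assume "g \<notin> A" "h \<notin> A"
    then show ?thesis
      using that wD(3)[of g h] by (simp add: flip_def)
  qed
  ultimately show ?thesis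
    unfolding current_def by blast
qed

theorem current_length_rational:
  assumes w: "current w" and "\<And>e. e \<in> H \<Longrightarrow> mass w e \<in> \<rat>"
  shows "\<exists>q\<in>\<rat>. current_length (\<lambda>x. x) w = q * pi"
proof (rule ccontr)
  assume "\<not> ?thesis"
  then have "\<And>q. q \<in> \<rat> \<Longrightarrow> current_length (\<lambda>x. x) w \<noteq> q * pi"
    by auto
  from additive_extension[OF _ this, of 0 1] obtain f where
    f: "Modules.additive f" "\<And>q z. q \<in> \<rat> \<Longrightarrow> f (q * z) = q * f z" "f pi = 0"
      "f (current_length (\<lambda>x. x) w) = 1"
    by auto
  have fw: "current_length f w = 1"
    using current_length_id_scale[OF f(1,2) assms(2)] f(4) by simp
  obtain q where q: "q \<in> \<rat>" "current_length (\<lambda>x. x) cyc = q * pi"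
    by (rule current_length_cyc_rational)
  have fc: "current_length f cyc = 0"
    using current_length_id_scale[OF f(1,2), of cyc] q f(2,3) by (auto simp: mass_cyc)
  have null: "current_length (\<lambda>x. x) cyc * current_length f v = pi * (\<Sum>e\<in>A. mass v e * f (len e))"
    if "current v" for v
  proof -
    have "(\<Sum>e\<in>H. mass cyc e * mass v e * f (len e)) =
        (\<Sum>e\<in>A. mass v e * f (len e))"
      by (subst sum_H_split) (simp add: mass_cyc in_H)
    then show ?thesis
      using current_length_null[OF f(1,3) current_cyc that fc] by simp
  qed
  define M where "M = 2 * (\<Sum>e\<in>H. mass w e)"
  have w': "current (flip w M)"
    using w by (rule current_flip) (simp add: M_def)
  define S where "S = (\<Sum>e\<in>A. mass w e * f (len e))"
  have "(\<Sum>e\<in>A. mass (flip w M) e * f (len e)) = (\<Sum>e\<in>A. M * f (len e) - mass w e * f (len e))"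
    using w by (intro sum.cong) (auto simp: mass_flip in_H algebra_simps)
  \<comment> \<open>The part with \<open>M\<close> is a multiple of
    \<open>current_length f cyc\<close>, which is zero.\<close>
  also have "\<dots> = - S"
    using fc by (simp add: sum_subtractf sum_distrib_left[symmetric] S_def current_length_cyc)
  finally have "current_length (\<lambda>x. x) cyc * current_length f (flip w M) = - (pi * S)"
    using null[OF w'] by simp
  moreover have "current_length (\<lambda>x. x) cyc * current_length f w = pi * S"
    using null[OF w] by (simp add: S_def)
  ultimately have "current_length (\<lambda>x. x) cyc * (current_length f (flip w M) + current_length f w) = 0"
    by (simp add: distrib_left)
  then have "current_length f (flip w M) = - 1"
    using current_length_cyc_pos fw by simp
  then show False
    using current_length_mult_nonneg[OF f(1,3) w w'] fw by simp
qed

end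

section \<open>Walks and distances in a metric graph\<close>

context metric_graph
begin

lemma edge_path_length_simps [simp]:
  "edge_path_length [] = 0"
  "edge_path_length (a # p) = len a + edge_path_length p"
  "edge_path_length (p @ q) = edge_path_length p + edge_path_length q"
  by (simp_all add: edge_path_length_def)

lemma edge_path_length_nonneg: "set p \<subseteq> arcs G \<Longrightarrow> 0 \<le> edge_path_length p"
  by (induction p) (auto intro: add_nonneg_nonneg less_imp_le[OF len_pos])

lemma edge_path_length_pos: "set p \<subseteq> arcs G \<Longrightarrow> p \<noteq> [] \<Longrightarrow> 0 < edge_path_length p"
  by (cases p) (auto intro: add_pos_nonneg len_pos edge_path_length_nonneg)

lemma awalk_length_nonneg: "awalk u p v \<Longrightarrow> 0 \<le> edge_path_length p"
  by (auto intro: edge_path_length_nonneg)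

definition reverse_walk :: "'e list \<Rightarrow> 'e list" where
  "reverse_walk p = map arev (rev p)"

lemma awalk_reverse: "awalk u p v \<Longrightarrow> awalk v (reverse_walk p) u"
proof (induction p arbitrary: u)
  case (Cons a p)
  then have "awalk v (reverse_walk p) (head G a)" "a \<in> arcs G" "u = tail G a"
    by (auto simp: awalk_Cons_iff)
  then show ?case
    using awalk_appendI[of v "reverse_walk p" "head G a" "[arev a]" u]
    by (simp add: reverse_walk_def awalk_simps)
qed (auto simp: reverse_walk_def awalk_Nil_iff)

lemma length_reverse: "set p \<subseteq> arcs G \<Longrightarrow> edge_path_length (reverse_walk p) = edge_path_length p"
  by (induction p) (auto simp: reverse_walk_def len_arev)

lemma mem_reverse: "a \<in> set (reverse_walk p) \<longleftrightarrow> arev a \<in> set p"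
  by (metis (no_types, lifting) arev_arev image_iff list.set_map reverse_walk_def set_rev)

text \<open>With \<open>m\<close> the least edge length, a walk of length at most \<open>c\<close>
  has at most \<open>c / m\<close> arcs, which leaves finitely many lists of lengths. The walks
  themselves may be infinitely many.\<close>

lemma finite_short_lengths: "finite (edge_path_length ` {p. set p \<subseteq> arcs G \<and> edge_path_length p \<le> c})"
proof (cases "arcs G = {}")
  case True
  then show ?thesis by (auto intro: finite_subset[of _ "{0}"])
next
  case False
  define m where "m = Min (len ` arcs G)"
  have "0 < m"
    using False finite_len len_pos by (auto simp: m_def)
  have m: "real (length p) * m \<le> edge_path_length p" if "set p \<subseteq> arcs G" for p
    using that
  proof (induction p)
    case (Cons a p)
    then have "m \<le> len a" using finite_len by (auto simp: m_def)
    with Cons show ?case by (simp add: algebra_simps)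
  qed simp
  have "edge_path_length ` {p. set p \<subseteq> arcs G \<and> edge_path_length p \<le> c}
      \<subseteq> sum_list ` {l. set l \<subseteq> len ` arcs G \<and> length l \<le> nat \<lceil>c / m\<rceil>}"
  proof (intro subsetI, elim imageE, simp, elim conjE)
    fix p assume p: "set p \<subseteq> arcs G" "edge_path_length p \<le> c"
    have "real (length p) \<le> c / m"
      using m[OF p(1)] p(2) \<open>0 < m\<close> by (simp add: field_simps)
    then have "length p \<le> nat \<lceil>c / m\<rceil>"
      by linarith
    then show "edge_path_length p \<in> sum_list ` {l. set l \<subseteq> len ` arcs G \<and> length l \<le> nat \<lceil>c / m\<rceil>}"
      using p(1) by (intro image_eqI[of _ _ "map len p"]) (auto simp: edge_path_length_def)
  qed
  then show ?thesis
    by (rule finite_subset) (intro finite_imageI finite_lists_length_le finite_len)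
qed

section \<open>Vertex distances and geodesics\<close>

definition linked :: "'v \<Rightarrow> 'v \<Rightarrow> bool" where
  "linked u v \<longleftrightarrow> (\<exists>p. awalk u p v)"

text \<open>Meaningful for \<open>linked\<close> vertices only, as the real infimum of the empty set
  is arbitrary.\<close>

definition vdist :: "'v \<Rightarrow> 'v \<Rightarrow> real" where
  "vdist u v = Inf (edge_path_length ` {p. awalk u p v})"

lemma vdist_le: "awalk u p v \<Longrightarrow> vdist u v \<le> edge_path_length p"
  unfolding vdist_def
  by (intro cINF_lower bdd_belowI[of _ 0]) (auto intro: awalk_length_nonneg)

lemma geodesic:
  assumes "linked u v"
  obtains p where "awalk u p v" "edge_path_length p = vdist u v"
proof -
  obtain q where q: "awalk u q v" using assms by (auto simp: linked_def)
  let ?S = "edge_path_length ` {p. awalk u p v \<and> edge_path_length p \<le> edge_path_length q}"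
  have "finite ?S"
    by (rule finite_subset[OF _ finite_short_lengths[of "edge_path_length q"]]) auto
  moreover have "?S \<noteq> {}" using q by auto
  ultimately have "Min ?S \<in> ?S" by (rule Min_in)
  then obtain p where p: "awalk u p v" "edge_path_length p = Min ?S" by auto
  have "edge_path_length p \<le> edge_path_length p'" if "awalk u p' v" for p'
  proof (cases "edge_path_length p' \<le> edge_path_length q")
    case True
    then show ?thesis using that p \<open>finite ?S\<close> by auto
  next
    case False
    moreover have "edge_path_length p \<le> edge_path_length q"
      using p q \<open>finite ?S\<close> by auto
    ultimately show ?thesis by simp
  qed
  then have "edge_path_length p = vdist u v"
    unfolding vdist_def using p(1) by (intro cInf_eq_minimum[symmetric]) auto
  with p that show thesis by blast
qed

lemma linked_sym: "linked u v \<Longrightarrow> linked v u"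
  unfolding linked_def using awalk_reverse by blast

lemma linked_trans: "linked u v \<Longrightarrow> linked v w \<Longrightarrow> linked u w"
  unfolding linked_def using awalk_appendI by blast

lemma vdist_sym_le: "linked u v \<Longrightarrow> vdist v u \<le> vdist u v"
  by (metis awalk_reverse awalkE' geodesic length_reverse vdist_le)

lemma vdist_sym: "linked u v \<Longrightarrow> vdist u v = vdist v u"
  by (simp add: antisym linked_sym vdist_sym_le)

lemma vdist_nonneg: "linked u v \<Longrightarrow> 0 \<le> vdist u v"
  by (metis awalk_length_nonneg geodesic)

lemma vdist_refl: "u \<in> verts G \<Longrightarrow> vdist u u = 0"
proof -
  assume "u \<in> verts G"
  then have "awalk u [] u" by (simp add: awalk_Nil_iff)
  then have "vdist u u \<le> 0" "linked u u"
    using vdist_le[of u "[]" u] by (auto simp: linked_def)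
  then show ?thesis using vdist_nonneg[of u u] by simp
qed

lemma vdist_edge:
  assumes "a \<in> arcs G" "linked (head G a) v"
  shows "vdist (tail G a) v \<le> len a + vdist (head G a) v"
proof -
  obtain p where "awalk (head G a) p v" "edge_path_length p = vdist (head G a) v"
    using geodesic[OF assms(2)] .
  then show ?thesis using vdist_le[of "tail G a" "a # p" v] assms by (simp add: awalk_Cons_iff)
qed

lemma vdist_edge_rev:
  assumes "a \<in> arcs G" "linked (tail G a) v"
  shows "vdist (head G a) v \<le> len a + vdist (tail G a) v"
  using vdist_edge[of "arev a" v] assms by (simp add: len_arev)

text \<open>A geodesic from \<open>tail G e\<close> does not contain \<open>arev e\<close>, which
  leads back to its start; if it contains \<open>e\<close>, its rest after \<open>e\<close> shows
  that starting with \<open>e\<close> is as short.\<close>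

lemma geodesic_through:
  assumes "e \<in> arcs G" and P: "awalk (tail G e) P y" "edge_path_length P = vdist (tail G e) y"
    and mem: "e \<in> set P \<or> arev e \<in> set P"
  shows "vdist (tail G e) y = vdist (head G e) y + len e"
proof -
  have "arev e \<notin> set P"
  proof
    assume "arev e \<in> set P"
    then obtain P1 P2 where eq: "P = P1 @ arev e # P2" by (auto simp: in_set_conv_decomp)
    then have "awalk (tail G e) P2 y" "set P1 \<subseteq> arcs G"
      using P(1) assms(1) by (auto simp: awalk_Cons_iff)
    then show False
      using vdist_le[of "tail G e" P2 y] P(2) edge_path_length_nonneg[of P1] len_pos[OF assms(1)]
      by (simp add: eq len_arev assms(1))
  qed
  with mem obtain P1 P2 where eq: "P = P1 @ e # P2" by (auto simp: in_set_conv_decomp)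
  then have P2: "awalk (head G e) P2 y" "set P1 \<subseteq> arcs G"
    using P(1) assms(1) by (auto simp: awalk_Cons_iff)
  then have "linked (head G e) y" by (auto simp: linked_def)
  then show ?thesis
    using vdist_le[OF P2(1)] P(2) edge_path_length_nonneg[OF P2(2)] vdist_edge[OF assms(1), of y]
    by (simp add: eq)
qed

section \<open>Parametrised edge-paths, embedded cycles and the girth\<close>

lemma edge_path_map_at:
  assumes "cas u p v" "set p \<subseteq> arcs G" "i < length p" "0 \<le> t" "t \<le> len (p ! i)"
  shows "edge_path_map p (edge_path_length (take i p) + t) = pt (p ! i) t"
  using assms
proof (induction p arbitrary: u i)
  case (Cons a p)
  show ?case
  proof (cases p)
    case Nil
    then show ?thesis using Cons.prems by simp
  next
    case p: (Cons b q)
    show ?thesis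
    proof (cases i)
      case 0
      then show ?thesis using Cons.prems p by simp
    next
      case (Suc j)
      have IH: "edge_path_map p (edge_path_length (take j p) + t) = pt (p ! j) t"
        using Cons.prems Suc by (intro Cons.IH[of "head G a"]) auto
      have sub: "set (take j p) \<subseteq> arcs G"
        using Cons.prems(2) set_take_subset[of j p] by auto
      show ?thesis
      \<comment> \<open>At a junction \<open>edge_path_map\<close> still uses the earlier arc
        \<open>a\<close>; its head is the tail of the next arc, so both formulas agree.\<close>
      proof (cases "edge_path_length (take j p) + t \<le> 0")
        case True
        then have "t = 0" "edge_path_length (take j p) = 0"
          using edge_path_length_nonneg[OF sub] Cons.prems(4) by linarith+
        then have "j = 0"
          using edge_path_length_pos[OF sub] p by (cases j) auto
        then show ?thesis
          using Suc p Cons.prems \<open>t = 0\<close> len_pos[of a] by (simp add: pt_def)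
      next
        case False
        then show ?thesis using IH Suc p by (simp add: algebra_simps)
      qed
    qed
  qed
qed simp

lemma edge_path_position:
  assumes "0 \<le> s" "s < edge_path_length p"
  obtains i t where "i < length p" "0 \<le> t" "t < len (p ! i)" "s = edge_path_length (take i p) + t"
  using assms
proof (induction p arbitrary: s thesis)
  case (Cons a p)
  show ?case
  proof (cases "s < len a")
    case True
    then show ?thesis using Cons.prems(1)[of 0 s] Cons.prems(2) by simp
  next
    case False
    then obtain i t where "i < length p" "0 \<le> t" "t < len (p ! i)"
      "s - len a = edge_path_length (take i p) + t"
      using Cons.IH[of "s - len a"] Cons.prems(2,3) by auto
    then show ?thesis using Cons.prems(1)[of "Suc i" t] by simp
  qed
qed simp

lemma circle_map_cis:
  assumes "0 \<le> s" "s < edge_path_length p"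
  shows "circle_map p (cis (2 * pi * s / edge_path_length p)) = edge_path_map p s"
proof -
  have "Arg2pi (cis (2 * pi * s / edge_path_length p)) = 2 * pi * s / edge_path_length p"
    using assms by (intro Arg2pi_unique[of 1]) (auto simp: cis_conv_exp field_simps)
  then show ?thesis
    using assms by (simp add: circle_map_def)
qed

lemma pt_eq_cases:
  assumes "a \<in> arcs G" "b \<in> arcs G" "s \<in> {0..len a}" "t \<in> {0..len b}" "pt a s = pt b t"
  obtains "b = a" "t = s" | "b = arev a" "t = len a - s"
    | w where "pt a s = Vertex w" "pt b t = Vertex w"
proof (cases "pt a s")
  case (Vertex w)
  then show ?thesis using that(3)[of w] assms(5) by simp
next
  case (Interior S)
  then have "S = {(a, s), (arev a, len a - s)}" "S = {(b, t), (arev b, len b - t)}"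
    using assms(5) by (auto simp: pt_def split: if_splits)
  then have "(b, t) = (a, s) \<or> (b, t) = (arev a, len a - s)"
    by blast
  then show ?thesis using that(1,2) by auto
qed

lemma pt_Vertex_iff:
  assumes "a \<in> arcs G" "s \<in> {0..len a}"
  shows "pt a s = Vertex w \<longleftrightarrow> s = 0 \<and> w = tail G a \<or> s = len a \<and> w = head G a"
  using assms len_pos[of a] by (auto simp: pt_def)

text \<open>Distinct tails keep vertices and arcs from recurring; \<open>no_rev\<close> excludes
  lists such as \<open>[a, arev a]\<close>, whose two arcs have the same points.\<close>

lemma simple_cycle_embedded:
  assumes p: "awalk u p u" "distinct (map (tail G) p)" and nonempty: "p \<noteq> []"
    and no_rev: "\<And>a. a \<in> set p \<Longrightarrow> arev a \<notin> set p"
  shows "embedded p"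
proof -
  let ?L = "edge_path_length p"
  have arcs: "set p \<subseteq> arcs G" and cas: "cas u p u" using p(1) by auto
  have inj: "inj_on (edge_path_map p) {0..<?L}"
  proof (rule inj_onI)
    fix s s' assume s: "s \<in> {0..<?L}" "s' \<in> {0..<?L}" and eq: "edge_path_map p s = edge_path_map p s'"
    obtain i t where i: "i < length p" "0 \<le> t" "t < len (p ! i)" "s = edge_path_length (take i p) + t"
      using edge_path_position[of s p] s by auto
    obtain j t' where j: "j < length p" "0 \<le> t'" "t' < len (p ! j)" "s' = edge_path_length (take j p) + t'"
      using edge_path_position[of s' p] s by auto
    have e: "pt (p ! i) t = pt (p ! j) t'"
      using eq edge_path_map_at[OF cas arcs i(1), of t] edge_path_map_at[OF cas arcs j(1), of t'] i j
      by simp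
    have a: "p ! i \<in> set p" "p ! j \<in> set p" "p ! i \<in> arcs G" "p ! j \<in> arcs G"
      using i j arcs by auto
    have "t \<in> {0..len (p ! i)}" "t' \<in> {0..len (p ! j)}" using i j by auto
    from a(3,4) this e have "i = j \<and> t = t'"
    proof (cases rule: pt_eq_cases)
      case 1
      then show ?thesis
        using p(2) i j by (auto simp: distinct_map nth_eq_iff_index_eq)
    next
      case 2
      then show ?thesis using no_rev a by metis
    next
      case (3 w)
      then have "t = 0" "t' = 0" "tail G (p ! i) = tail G (p ! j)"
        using pt_Vertex_iff[OF a(3), of t] pt_Vertex_iff[OF a(4), of t'] i j by auto
      then show ?thesis
        using p(2) i j by (auto simp: distinct_conv_nth)
    qed
    then show "s = s'" using i j by simp
  qed
  show ?thesis
    unfolding embedded_def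
  proof (rule inj_onI)
    fix z z' :: complex
    assume z: "z \<in> sphere 0 1" "z' \<in> sphere 0 1" and eq: "circle_map p z = circle_map p z'"
    show "z = z'"
    proof -
      have "0 < ?L" using arcs nonempty by (simp add: edge_path_length_pos)
      have "?L * (Arg2pi x / (2 * pi)) \<in> {0..<?L}" for x
        using Arg2pi_ge_0[of x] Arg2pi_lt_2pi[of x] \<open>0 < ?L\<close> by (auto simp: field_simps)
      then have "?L * (Arg2pi z / (2 * pi)) = ?L * (Arg2pi z' / (2 * pi))"
        using eq inj unfolding circle_map_def by (meson inj_onD)
      then have "Arg2pi z = Arg2pi z'" using \<open>0 < ?L\<close> by simp
      then show ?thesis
        using z Arg2pi_eq[of z] Arg2pi_eq[of z'] by simp
    qed
  qed
qed

lemma girth_le_simple_cycle: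
  assumes "awalk u p u" "distinct (map (tail G) p)" "p \<noteq> []" "\<And>a. a \<in> set p \<Longrightarrow> arev a \<notin> set p"
  shows "girth \<le> ereal (edge_path_length p)"
proof -
  have "closed_w p" using assms by (auto simp: closed_w_def)
  then show ?thesis
    using simple_cycle_embedded[OF assms] unfolding girth_def by (intro Inf_lower) auto
qed

lemma apath_no_reverse:
  assumes "apath u p v" "a \<in> set p"
  shows "arev a \<notin> set p"
proof
  assume rev: "arev a \<in> set p"
  from assms(2) obtain q r where p: "p = q @ a # r" by (auto simp: in_set_conv_decomp)
  have arcs: "a \<in> arcs G" using assms by (auto simp: apath_def)
  have w: "awalk u p v" and d: "distinct (awalk_verts u p)" using assms by (auto simp: apath_def)
  have verts: "awalk_verts u p = map (tail G) q @ tail G a # awalk_verts (head G a) r"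
    by (simp add: p awalk_verts_conv)
  have r: "awalk (head G a) r v" using w by (simp add: p awalk_Cons_iff)
  have "head G a \<in> set (awalk_verts (head G a) r)"
    using r by (rule hd_in_awalk_verts)
  moreover have "head G a \<in> tail G ` set q" if "arev a \<in> set q"
    using that arcs by (metis image_eqI tail_arev)
  moreover have "tail G a \<in> set (awalk_verts (head G a) r)" if "arev a \<in> set r"
    using awalk_verts_arc2[OF r that] arcs by simp
  ultimately show False
    using rev d arev_neq[OF arcs] unfolding verts by (auto simp: p)
qed

text \<open>Cutting closed subwalks out of \<open>p\<close> does not lengthen it and keeps it free
  of \<open>e\<close> and \<open>arev e\<close>. Once \<open>p\<close> is a path,
  \<open>e # p\<close> is a simple cycle.\<close>

lemma girth_le_edge_once:
  assumes "e \<in> arcs G" "awalk (head G e) p (tail G e)" "e \<notin> set p" "arev e \<notin> set p"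
  shows "girth \<le> ereal (len e + edge_path_length p)"
  using assms
proof (induction "length p" arbitrary: p rule: less_induct)
  case less
  show ?case
  proof (cases "distinct (awalk_verts (head G e) p)")
    case True
    then have path: "apath (head G e) p (tail G e)" using less.prems by (simp add: apath_def)
    have "distinct (map (tail G) (e # p))"
      using True awlast_of_awalk[OF less.prems(2)] by (auto simp: awalk_verts_conv split: if_splits)
    moreover have "arev a \<notin> set (e # p)" if "a \<in> set (e # p)" for a
      using that less.prems(3,4) apath_no_reverse[OF path, of a] arev_neq[OF assms(1)] by auto
    ultimately have "girth \<le> ereal (edge_path_length (e # p))"
      using less.prems by (intro girth_le_simple_cycle[of "tail G e"]) (auto simp: awalk_Cons_iff)
    then show ?thesis by simp
  next
    case False
    obtain q r s w where p: "p = q @ r @ s" "0 < length r"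
      and w: "awalk (head G e) q w" "awalk w r w" "awalk w s (tail G e)"
      using awalk_not_distinct_decomp[OF less.prems(2) False] by blast
    have "girth \<le> ereal (len e + edge_path_length (q @ s))"
      using less.prems p awalk_appendI[OF w(1,3)] by (intro less.hyps) auto
    also have "\<dots> \<le> ereal (len e + edge_path_length p)"
      using awalk_length_nonneg[OF w(2)] by (simp add: p)
    finally show ?thesis .
  qed
qed

section \<open>Reducing piecewise linear paths to walks between vertices\<close>

definition touches :: "('v, 'e) mg_point \<Rightarrow> 'v \<Rightarrow> real \<Rightarrow> bool" where
  "touches X u c \<longleftrightarrow> X = Vertex u \<and> c = 0 \<or> (\<exists>a\<in>arcs G. c \<in> {0..len a} \<and> X = pt a c \<and> u = tail G a)"

text \<open>A normal form of piecewise linear paths: inside one closed edge, or straight to a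
  vertex, along whole arcs, and straight to the end. As \<open>r\<close> is only an upper bound,
  detours inside an edge may be straightened.\<close>

definition route :: "('v, 'e) mg_point \<Rightarrow> real \<Rightarrow> ('v, 'e) mg_point \<Rightarrow> bool" where
  "route X r Y \<longleftrightarrow>
    (\<exists>b\<in>arcs G. \<exists>s\<in>{0..len b}. \<exists>t\<in>{0..len b}. X = pt b s \<and> Y = pt b t \<and> \<bar>s - t\<bar> \<le> r) \<or>
    (\<exists>u v p c d. touches X u c \<and> awalk u p v \<and> touches Y v d \<and> c + edge_path_length p + d \<le> r)"

lemma touches_tail: "a \<in> arcs G \<Longrightarrow> t \<in> {0..len a} \<Longrightarrow> touches (pt a t) (tail G a) t"
  by (auto simp: touches_def)

lemma touches_head: "a \<in> arcs G \<Longrightarrow> t \<in> {0..len a} \<Longrightarrow> touches (pt a t) (head G a) (len a - t)"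
  using touches_tail[of "arev a" "len a - t"] by (simp add: len_arev pt_arev)

lemma touches_end:
  assumes "a \<in> arcs G" "s \<in> {0..len a}" "t \<in> {0..len a}" "pt a t = Vertex w"
  shows "touches (pt a s) w \<bar>s - t\<bar>"
  using assms pt_Vertex_iff[OF assms(1,3)] touches_tail[OF assms(1,2)] touches_head[OF assms(1,2)]
  by auto

lemma routeI:
  "touches X u c \<Longrightarrow> awalk u p v \<Longrightarrow> touches Y v d \<Longrightarrow> c + edge_path_length p + d \<le> r \<Longrightarrow> route X r Y"
  unfolding route_def by blast

text \<open>A new segment in the edge used last is merged with the previous one by the triangle
  inequality; otherwise the junction is a vertex, where a walk can be started or extended.\<close>

lemma pl_path_route: "pl_path X r Y \<Longrightarrow> route X r Y"
proof (induction rule: pl_path.induct)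
  case (trivial X)
  then consider v where "v \<in> verts G" "X = Vertex v"
    | a t where "a \<in> arcs G" "t \<in> {0..len a}" "X = pt a t"
    by (auto simp: points_def)
  then show ?case
  proof cases
    case 1
    then show ?thesis
      by (intro routeI[of _ v 0 "[]" v _ 0]) (auto simp: touches_def awalk_Nil_iff)
  next
    case 2
    then show ?thesis unfolding route_def by fastforce
  qed
next
  case (segment X r a s t)
  note a = \<open>a \<in> arcs G\<close> and s = \<open>s \<in> {0..len a}\<close> and t = \<open>t \<in> {0..len a}\<close>
  from segment.IH consider (same) b s' t' where "b \<in> arcs G" "s' \<in> {0..len b}" "t' \<in> {0..len b}"
      "X = pt b s'" "pt a s = pt b t'" "\<bar>s' - t'\<bar> \<le> r"
    | (walk) u v p c d where "touches X u c" "awalk u p v" "touches (pt a s) v d"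
      "c + edge_path_length p + d \<le> r"
    unfolding route_def by blast
  then show ?case
  proof cases
    case same
    from a same(1) s same(3,5) show ?thesis
    proof (cases rule: pt_eq_cases)
      case 1
      then show ?thesis
        unfolding route_def using same a t by (intro disjI1 bexI[of _ a] bexI[of _ s'] bexI[of _ t]) auto
    next
      case 2
      then have "X = pt a (len a - s')"
        using same pt_arev[of "arev a" s'] a pt_arev[of a "len a - s'"] by simp
      then show ?thesis
        unfolding route_def using same a t 2
        by (intro disjI1 bexI[of _ a] bexI[of _ "len a - s'"] bexI[of _ t]) (auto simp: len_arev)
    next
      case (3 w)
      have "w \<in> verts G" using 3 a s pt_Vertex_iff[OF a s] by auto
      moreover have "touches X w \<bar>s' - t'\<bar>"
        using same 3 touches_end by auto
      moreover have "touches (pt a t) w \<bar>t - s\<bar>"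
        using touches_end[OF a t s] 3 by auto
      ultimately show ?thesis
        using same by (intro routeI[of _ w _ "[]" w]) (auto simp: awalk_Nil_iff)
    qed
  next
    case walk
    from walk(3) consider (vertex) "pt a s = Vertex v" "d = 0"
      | (edge) b where "b \<in> arcs G" "d \<in> {0..len b}" "pt a s = pt b d" "v = tail G b"
      unfolding touches_def by blast
    then show ?thesis
    proof cases
      case vertex
      then show ?thesis
        using routeI[OF walk(1,2) touches_end[OF a t s vertex(1)]] walk(4) by simp
    next
      case edge
      from a edge(1) s edge(2,3) show ?thesis
      proof (cases rule: pt_eq_cases)
        case 1
        then show ?thesis
          using routeI[OF walk(1,2), of "pt a t" t] touches_tail[OF a t] walk(4) edge by auto
      next
        case 2
        then show ?thesis
          using routeI[OF walk(1,2), of "pt a t" "len a - t"] touches_head[OF a t] walk(4) edge a by auto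
      next
        case (3 w)
        have tw: "touches (pt a t) w \<bar>t - s\<bar>" using touches_end[OF a t s 3(1)] .
        consider "d = 0" "w = v" | "d = len b" "w = head G b"
          using pt_Vertex_iff[OF edge(1,2)] 3 edge by auto
        then show ?thesis
        proof cases
          case 1
          then show ?thesis using routeI[OF walk(1,2)] tw walk(4) by simp
        next
          case 2
          have "awalk v [b] w"
            using arc_implies_awalk[OF edge(1)] edge(4) 2 by simp
          note w = awalk_appendI[OF walk(2) this]
          show ?thesis using routeI[OF walk(1) w tw] walk(4) 2 by simp
        qed
      qed
    qed
  qed
qed

definition edge_exit :: "'e \<Rightarrow> real \<Rightarrow> 'v \<Rightarrow> real \<Rightarrow> bool" where
  "edge_exit e x v c \<longleftrightarrow> v = tail G e \<and> c = x \<or> v = head G e \<and> c = len e - x"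

lemma touches_Vertex:
  assumes "touches (Vertex y) v c" "y \<in> verts G"
  obtains q where "awalk v q y" "edge_path_length q \<le> c"
proof -
  from assms(1) consider "y = v" "c = 0" | a where "a \<in> arcs G" "c \<in> {0..len a}" "Vertex y = pt a c" "v = tail G a"
    unfolding touches_def by auto
  then show thesis
  proof cases
    case 1
    then show thesis using that[of "[]"] assms by (simp add: awalk_Nil_iff)
  next
    case 2
    then consider "c = 0" "y = v" | "c = len a" "y = head G a"
      using pt_Vertex_iff[of a c y] by auto
    then show thesis
    proof cases
      case 1
      then show thesis using that[of "[]"] assms by (simp add: awalk_Nil_iff)
    next
      case 2
      then show thesis using that[of "[a]"] \<open>a \<in> arcs G\<close> \<open>v = tail G a\<close> by (simp add: awalk_simps)
    qed
  qed
qed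

text \<open>An interior point of \<open>e\<close> touches only the ends of \<open>e\<close>. If
  \<open>pt e x\<close> is a vertex, it is itself an end of \<open>e\<close>, and the touching arc
  becomes the walk \<open>q\<close>.\<close>

lemma touches_exit:
  assumes "touches (pt e x) u c" "e \<in> arcs G" "x \<in> {0..len e}"
  obtains v d q where "edge_exit e x v d" "awalk v q u" "d + edge_path_length q \<le> c"
proof -
  note result = that
  have vertex: thesis if w: "pt e x = Vertex w" "touches (Vertex w) u c" for w
  proof -
    have "w \<in> verts G" using pt_Vertex_iff[OF assms(2,3), of w] w assms(2) by auto
    obtain q where q: "awalk u q w" "edge_path_length q \<le> c"
      using touches_Vertex[OF w(2) \<open>w \<in> verts G\<close>] .
    have "edge_exit e x w 0"
      using pt_Vertex_iff[OF assms(2,3), of w] w(1) by (auto simp: edge_exit_def)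
    then show thesis
      using result[of w 0 "reverse_walk q"] awalk_reverse[OF q(1)] q length_reverse[of q] by auto
  qed
  show thesis
  proof (cases "\<exists>w. pt e x = Vertex w")
    case True
    then show thesis using vertex assms(1) by auto
  next
    case False
    then obtain a where a: "a \<in> arcs G" "c \<in> {0..len a}" "pt e x = pt a c" "u = tail G a"
      using assms(1) by (auto simp: touches_def)
    from assms(2) a(1) assms(3) a(2,3) show thesis
    proof (cases rule: pt_eq_cases)
      case 1
      then show thesis
        using that[of u c "[]"] a by (auto simp: edge_exit_def awalk_Nil_iff)
    next
      case 2
      then show thesis
        using that[of u c "[]"] a assms(2) by (auto simp: edge_exit_def awalk_Nil_iff)
    next
      case 3
      then show thesis using False by auto
    qed
  qed
qed

lemma route_vertex:
  assumes "route (pt e x) r (Vertex y)" "e \<in> arcs G" "x \<in> {0..len e}" "y \<in> verts G"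
  obtains v c where "edge_exit e x v c" "c + vdist v y \<le> r"
proof -
  note result = that
  have touch: thesis if u: "touches (pt e x) u c" "awalk u p y" "c + edge_path_length p \<le> r" for u c p
  proof -
    obtain v d q where v: "edge_exit e x v d" "awalk v q u" "d + edge_path_length q \<le> c"
      using touches_exit[OF u(1) assms(2,3)] .
    show thesis
      using result[OF v(1)] vdist_le[OF awalk_appendI[OF v(2) u(2)]] v(3) u(3) by simp
  qed
  from assms(1) consider b s t where "b \<in> arcs G" "s \<in> {0..len b}" "t \<in> {0..len b}" "pt e x = pt b s"
      "Vertex y = pt b t" "\<bar>s - t\<bar> \<le> r"
    | u v p c d where "touches (pt e x) u c" "awalk u p v" "touches (Vertex y) v d"
      "c + edge_path_length p + d \<le> r"
    unfolding route_def by blast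
  then show thesis
  proof cases
    case 1
    then have "touches (pt e x) y \<bar>s - t\<bar>" using touches_end[of b s t y] by simp
    then show thesis using touch[of y _ "[]"] assms(4) 1 by (simp add: awalk_Nil_iff)
  next
    case 2
    obtain q where q: "awalk v q y" "edge_path_length q \<le> d"
      using touches_Vertex[OF 2(3) assms(4)] .
    show thesis
      using touch[OF 2(1) awalk_appendI[OF 2(2) q(1)]] q(2) 2(4) by simp
  qed
qed

lemma route_points:
  assumes "route (pt e x) r (pt f y)" and e: "e \<in> arcs G" "x \<in> {0..len e}"
    and f: "f \<in> arcs G" "y \<in> {0..len f}" and ne: "f \<noteq> e" "f \<noteq> arev e"
  obtains v c w d where "edge_exit e x v c" "edge_exit f y w d" "c + vdist v w + d \<le> r"
proof -
  note result = that
  have touch: thesis if T: "touches (pt e x) u c" "awalk u p u'" "touches (pt f y) u' d"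
    "c + edge_path_length p + d \<le> r" for u c p u' d
  proof -
    obtain v c' q where v: "edge_exit e x v c'" "awalk v q u" "c' + edge_path_length q \<le> c"
      using touches_exit[OF T(1) e] .
    obtain w d' q' where w: "edge_exit f y w d'" "awalk w q' u'" "d' + edge_path_length q' \<le> d"
      using touches_exit[OF T(3) f] .
    have "awalk v (q @ p @ reverse_walk q') w"
      using awalk_appendI[OF v(2) awalk_appendI[OF T(2) awalk_reverse[OF w(2)]]] .
    from vdist_le[OF this] show thesis
      using result[OF v(1) w(1)]
        v(3) w(3) T(4) length_reverse[of q'] w(2) by auto
  qed
  from assms(1) consider b s t where "b \<in> arcs G" "s \<in> {0..len b}" "t \<in> {0..len b}" "pt e x = pt b s"
      "pt f y = pt b t" "\<bar>s - t\<bar> \<le> r"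
    | u v p c d where "touches (pt e x) u c" "awalk u p v" "touches (pt f y) v d"
      "c + edge_path_length p + d \<le> r"
    unfolding route_def by blast
  then show thesis
  proof cases
    case 1
    \<comment> \<open>The edge \<open>b\<close> cannot be both \<open>e\<close> and \<open>f\<close>
      up to reversal, so one of the two points is a vertex.\<close>
    consider w where "pt e x = Vertex w" "pt b s = Vertex w" | w where "pt f y = Vertex w" "pt b t = Vertex w"
      | "b = e \<or> b = arev e" "b = f \<or> b = arev f"
      using pt_eq_cases[OF e(1) 1(1) e(2) 1(2,4)] pt_eq_cases[OF f(1) 1(1) f(2) 1(3,5)] by metis
    then show thesis
    proof cases
      case (1 w)
      then have "touches (pt f y) w \<bar>t - s\<bar>"
        using touches_end[of b t s w] \<open>b \<in> arcs G\<close> \<open>s \<in> _\<close> \<open>t \<in> _\<close> \<open>pt f y = pt b t\<close> by simp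
      moreover have "touches (pt e x) w 0" using 1 by (simp add: touches_def)
      moreover have "w \<in> verts G" using 1 pt_Vertex_iff[OF e] e by auto
      ultimately show thesis
        using touch[of w 0 "[]" w] \<open>\<bar>s - t\<bar> \<le> r\<close> by (simp add: awalk_Nil_iff)
    next
      case (2 w)
      then have "touches (pt e x) w \<bar>s - t\<bar>"
        using touches_end[of b s t w] \<open>b \<in> arcs G\<close> \<open>s \<in> _\<close> \<open>t \<in> _\<close> \<open>pt e x = pt b s\<close> by simp
      moreover have "touches (pt f y) w 0" using 2 by (simp add: touches_def)
      moreover have "w \<in> verts G" using 2 pt_Vertex_iff[OF f] f by auto
      ultimately show thesis
        using touch[of w _ "[]" w 0] \<open>\<bar>s - t\<bar> \<le> r\<close> by (simp add: awalk_Nil_iff)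
    next
      case 3
      then show thesis using ne by (metis arev_arev)
    qed
  next
    case 2
    then show thesis by (rule touch)
  qed
qed

lemma short_route:
  assumes "mg_dist X Y \<le> ereal c" "c < c'"
  obtains r where "r < c'" "route X r Y"
proof -
  have "mg_dist X Y < ereal c'" using assms by (simp add: le_less_trans)
  then obtain r where "r < c'" "pl_path X r Y"
    unfolding mg_dist_def Inf_less_iff by auto
  then show thesis using that pl_path_route by auto
qed

lemma dist_vertex_le:
  assumes "mg_dist (pt e x) (Vertex y) \<le> ereal c" "e \<in> arcs G" "x \<in> {0..len e}" "y \<in> verts G"
  shows "x + vdist (tail G e) y \<le> c \<or> (len e - x) + vdist (head G e) y \<le> c"
proof (rule ccontr)
  assume "\<not> ?thesis"
  then obtain r where "r < min (x + vdist (tail G e) y) ((len e - x) + vdist (head G e) y)"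
    "route (pt e x) r (Vertex y)"
    using short_route[OF assms(1), of "min (x + vdist (tail G e) y) ((len e - x) + vdist (head G e) y)"]
    by auto
  then show False
    using assms by (elim route_vertex) (auto simp: edge_exit_def)
qed

text \<open>If all four lengths exceeded \<open>c\<close>, some route would be shorter than the
  least of them; but a route between different edges leaves each of them through an end. The strict
  gap is needed because \<open>mg_dist\<close> is an infimum.\<close>

lemma dist_points_le:
  assumes "mg_dist (pt e x) (pt f y) \<le> ereal c" and e: "e \<in> arcs G" "x \<in> {0..len e}"
    and f: "f \<in> arcs G" "y \<in> {0..len f}" and ne: "f \<noteq> e" "f \<noteq> arev e"
  shows "x + y + vdist (tail G e) (tail G f) \<le> c \<or> (len e - x) + y + vdist (head G e) (tail G f) \<le> c \<or>
    x + (len f - y) + vdist (tail G e) (head G f) \<le> c \<or>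
    (len e - x) + (len f - y) + vdist (head G e) (head G f) \<le> c" (is "?A \<le> c \<or> ?B \<le> c \<or> ?C \<le> c \<or> ?D \<le> c")
proof (rule ccontr)
  assume "\<not> ?thesis"
  then have "c < min (min ?A ?B) (min ?C ?D)" by auto
  then obtain r where r: "r < min (min ?A ?B) (min ?C ?D)" "route (pt e x) r (pt f y)"
    using short_route[OF assms(1)] by blast
  from r(2) e f ne obtain v c1 w c2 where "edge_exit e x v c1" "edge_exit f y w c2" "c1 + vdist v w + c2 \<le> r"
    by (rule route_points)
  with r(1) show False by (auto simp: edge_exit_def)
qed

end

section \<open>Consequences of the girth and the distance bound\<close>

locale taut_metric_graph = metric_graph +
  fixes H :: "'b set"
  assumes H_arcs: "H \<subseteq> arcs G" and H_finite: "finite H"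
    and H_arev: "e \<in> H \<Longrightarrow> arev e \<in> H"
    and girth: "girth \<ge> ereal (2 * pi)"
    and H_linked: "e \<in> H \<Longrightarrow> f \<in> H \<Longrightarrow> linked (tail G e) (tail G f)"
    and H_dist: "e \<in> H \<Longrightarrow> f \<in> H \<Longrightarrow> x \<in> {0..len e} \<Longrightarrow> y \<in> {0..len f} \<Longrightarrow>
      mg_dist (pt e x) (pt f y) \<le> ereal pi"
begin

lemma arc: "e \<in> H \<Longrightarrow> e \<in> arcs G"
  using H_arcs by auto

lemma H_linked_head: "e \<in> H \<Longrightarrow> f \<in> H \<Longrightarrow> linked (head G e) (tail G f)"
  using H_linked[of "arev e" f] by (simp add: H_arev arc)

lemma edge_once_length:
  assumes "e \<in> arcs G" "awalk (head G e) p (tail G e)" "e \<notin> set p" "arev e \<notin> set p"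
  shows "2 * pi \<le> len e + edge_path_length p"
  using order_trans[OF girth girth_le_edge_once[OF assms]] by simp

lemma vertex_cover:
  assumes "e \<in> H" "f \<in> H" "x \<in> {0..len e}"
  shows "x + vdist (tail G e) (tail G f) \<le> pi \<or> (len e - x) + vdist (head G e) (tail G f) \<le> pi"
proof (rule dist_vertex_le)
  show "mg_dist (pt e x) (Vertex (tail G f)) \<le> ereal pi"
    using H_dist[OF assms, of 0] len_pos[OF arc[OF assms(2)]] by (simp add: pt_def)
qed (use assms arc in auto)

lemma vdist_le_pi:
  assumes "e \<in> H" "f \<in> H"
  shows "vdist (tail G e) (tail G f) \<le> pi"
  using vertex_cover[OF assms, of 0] vdist_edge[OF arc[OF assms(1)] H_linked_head[OF assms]]
    len_pos[OF arc[OF assms(1)]] by auto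

lemma H_geodesic:
  assumes "e \<in> H" "f \<in> H"
  obtains P where "awalk (tail G e) P (tail G f)" "edge_path_length P = vdist (tail G e) (tail G f)"
    "vdist (tail G e) (tail G f) = vdist (head G e) (tail G f) + len e \<or> e \<notin> set P \<and> arev e \<notin> set P"
proof -
  obtain P where P: "awalk (tail G e) P (tail G f)" "edge_path_length P = vdist (tail G e) (tail G f)"
    using geodesic[OF H_linked[OF assms]] .
  then show thesis
    using that[OF P] geodesic_through[OF arc[OF assms(1)] P] by blast
qed

text \<open>If neither geodesic from the ends of \<open>e\<close> to \<open>tail G f\<close> runs
  along \<open>e\<close>, the two form with \<open>e\<close> a closed walk that uses
  \<open>e\<close> once, so the girth gives \<open>p + q \<le> len e\<close>. The distance bound
  gives the converse inequality.\<close>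

lemma side:
  assumes "e \<in> H" "f \<in> H"
  defines "p \<equiv> pi - vdist (tail G e) (tail G f)" and "q \<equiv> pi - vdist (head G e) (tail G f)"
  shows "p + q = len e \<or> q = p + len e \<or> p = q + len e"
proof (rule ccontr)
  assume ne: "\<not> ?thesis"
  have e: "e \<in> arcs G" "arev e \<in> H" using assms(1) by (simp_all add: arc H_arev)
  obtain P where P: "awalk (tail G e) P (tail G f)" "edge_path_length P = vdist (tail G e) (tail G f)"
    "vdist (tail G e) (tail G f) = vdist (head G e) (tail G f) + len e \<or> e \<notin> set P \<and> arev e \<notin> set P"
    using H_geodesic[OF assms(1,2)] .
  obtain Q where Q: "awalk (head G e) Q (tail G f)" "edge_path_length Q = vdist (head G e) (tail G f)"
    "vdist (head G e) (tail G f) = vdist (tail G e) (tail G f) + len e \<or> e \<notin> set Q \<and> arev e \<notin> set Q"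
    using H_geodesic[OF e(2) assms(2)]
    unfolding tail_arev[OF e(1)] head_arev[OF e(1)] len_arev[OF e(1)] arev_arev by blast
  have avoid: "e \<notin> set P" "arev e \<notin> set P" "e \<notin> set Q" "arev e \<notin> set Q"
    using P(3) Q(3) ne by (auto simp: p_def q_def)
  have "awalk (head G e) (Q @ reverse_walk P) (tail G e)"
    using awalk_appendI[OF Q(1) awalk_reverse[OF P(1)]] .
  then have "2 * pi \<le> len e + edge_path_length (Q @ reverse_walk P)"
    using avoid by (intro edge_once_length e) (simp_all add: mem_reverse)
  then have "p + q \<le> len e"
    using P(1,2) Q(2) length_reverse[of P] by (auto simp: p_def q_def)
  \<comment> \<open>At \<open>(len e + p - q) / 2\<close> the ways to \<open>tail G f\<close>
    through the two ends of \<open>e\<close> are equally long.\<close>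
  moreover have "p + q \<ge> len e"
    using vertex_cover[OF assms(1,2), of "(len e + p - q) / 2"]
      vdist_edge[OF e(1) H_linked_head[OF assms(1,2)]] vdist_edge_rev[OF e(1) H_linked[OF assms(1,2)]]
      by (auto simp: p_def q_def field_simps)
  ultimately show False using ne p_def q_def by auto
qed

text \<open>The last two alternatives say that a geodesic between the tails or between the heads can
  run along \<open>e\<close>. Otherwise these geodesics form with \<open>e\<close> and
  \<open>f\<close> a closed walk using \<open>e\<close> once, of length at least
  \<open>2 * pi\<close>.\<close>

lemma opposite:
  assumes "e \<in> H" "f \<in> H" "f \<noteq> e" "f \<noteq> arev e"
  defines "p \<equiv> \<lambda>u v. pi - vdist u v"
  shows "p (tail G e) (tail G f) + p (head G e) (head G f) \<le> len e + len f \<or>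
    p (head G e) (tail G f) = p (tail G e) (tail G f) + len e \<or>
    p (tail G e) (head G f) = p (head G e) (head G f) + len e"
proof (rule ccontr)
  assume ne: "\<not> ?thesis"
  have e: "e \<in> arcs G" "arev e \<in> H" and f: "f \<in> arcs G" "arev f \<in> H"
    using assms(1,2) by (simp_all add: arc H_arev)
  obtain P where P: "awalk (tail G e) P (tail G f)" "edge_path_length P = vdist (tail G e) (tail G f)"
    "vdist (tail G e) (tail G f) = vdist (head G e) (tail G f) + len e \<or> e \<notin> set P \<and> arev e \<notin> set P"
    using H_geodesic[OF assms(1,2)] .
  obtain Q where Q: "awalk (head G e) Q (head G f)" "edge_path_length Q = vdist (head G e) (head G f)"
    "vdist (head G e) (head G f) = vdist (tail G e) (head G f) + len e \<or> e \<notin> set Q \<and> arev e \<notin> set Q"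
    using H_geodesic[OF e(2) f(2)]
    unfolding tail_arev[OF e(1)] tail_arev[OF f(1)] head_arev[OF e(1)] len_arev[OF e(1)] arev_arev by blast
  have avoid: "e \<notin> set P" "arev e \<notin> set P" "e \<notin> set Q" "arev e \<notin> set Q"
    using P(3) Q(3) ne by (auto simp: p_def)
  have "awalk (head G f) [arev f] (tail G f)"
    using arc_implies_awalk[of "arev f"] f(1) by simp
  from awalk_appendI[OF Q(1) awalk_appendI[OF this awalk_reverse[OF P(1)]]]
  have "awalk (head G e) (Q @ [arev f] @ reverse_walk P) (tail G e)" .
  then have "2 * pi \<le> len e + edge_path_length (Q @ [arev f] @ reverse_walk P)"
    using avoid assms(3,4) by (intro edge_once_length e) (auto simp: mem_reverse arev_eq_iff)
  then show False
    using ne P(1,2) Q(2) length_reverse[of P] f(1) by (auto simp: p_def len_arev)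
qed

lemma covered:
  assumes "e \<in> H" "f \<in> H" "f \<noteq> e" "f \<noteq> arev e"
  defines "p \<equiv> \<lambda>u v. pi - vdist u v"
  shows "covered_cell (len e) (len f) (p (tail G e) (tail G f)) (p (head G e) (tail G f))
    (p (tail G e) (head G f)) (p (head G e) (head G f))"
proof
  have e: "e \<in> arcs G" "arev e \<in> H" and f: "f \<in> arcs G" "arev f \<in> H"
    using assms(1,2) by (simp_all add: arc H_arev)
  have sym: "vdist (tail G f) (tail G e) = vdist (tail G e) (tail G f)"
    "vdist (head G f) (tail G e) = vdist (tail G e) (head G f)"
    "vdist (tail G f) (head G e) = vdist (head G e) (tail G f)"
    "vdist (head G f) (head G e) = vdist (head G e) (head G f)"
    using vdist_sym[OF H_linked, of e f] vdist_sym[OF H_linked, of e "arev f"] vdist_sym[OF H_linked, of "arev e" f]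
      vdist_sym[OF H_linked, of "arev e" "arev f"] assms(1,2) e f by auto
  show "0 < len e" "0 < len f" using e f by (auto intro: len_pos)
  show "0 \<le> p (tail G e) (tail G f)" "0 \<le> p (head G e) (tail G f)"
    "0 \<le> p (tail G e) (head G f)" "0 \<le> p (head G e) (head G f)"
    using vdist_le_pi[of e f] vdist_le_pi[of "arev e" f] vdist_le_pi[of e "arev f"]
      vdist_le_pi[of "arev e" "arev f"] assms(1,2) e f by (auto simp: p_def)
  show "p (tail G e) (tail G f) + p (head G e) (tail G f) = len e \<or>
      p (head G e) (tail G f) = p (tail G e) (tail G f) + len e \<or>
      p (tail G e) (tail G f) = p (head G e) (tail G f) + len e"
    using side[OF assms(1,2)] by (simp add: p_def)
  show "p (tail G e) (head G f) + p (head G e) (head G f) = len e \<or>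
      p (head G e) (head G f) = p (tail G e) (head G f) + len e \<or>
      p (tail G e) (head G f) = p (head G e) (head G f) + len e"
    using side[OF assms(1) f(2)] f(1) by (simp add: p_def)
  show "p (tail G e) (tail G f) + p (tail G e) (head G f) = len f \<or>
      p (tail G e) (head G f) = p (tail G e) (tail G f) + len f \<or>
      p (tail G e) (tail G f) = p (tail G e) (head G f) + len f"
    using side[OF assms(2,1)] by (simp add: p_def sym)
  show "p (head G e) (tail G f) + p (head G e) (head G f) = len f \<or>
      p (head G e) (head G f) = p (head G e) (tail G f) + len f \<or>
      p (head G e) (tail G f) = p (head G e) (head G f) + len f"
    using side[OF assms(2) e(2)] e(1) by (simp add: p_def sym)
  have ne: "e \<noteq> f" "e \<noteq> arev f" "f \<noteq> arev (arev e)" "arev f \<noteq> e" "arev f \<noteq> arev e"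
    using assms(3,4) by (auto simp: arev_eq_iff)
  show "p (tail G e) (tail G f) + p (head G e) (head G f) \<le> len e + len f \<or>
      p (head G e) (tail G f) = p (tail G e) (tail G f) + len e \<or>
      p (tail G e) (head G f) = p (head G e) (head G f) + len e"
    using opposite[OF assms(1-4)] by (simp add: p_def)
  show "p (tail G e) (tail G f) + p (head G e) (head G f) \<le> len e + len f \<or>
      p (tail G e) (head G f) = p (tail G e) (tail G f) + len f \<or>
      p (head G e) (tail G f) = p (head G e) (head G f) + len f"
    using opposite[OF assms(2,1) ne(1,2)] by (simp add: p_def sym add.commute)
  show "p (head G e) (tail G f) + p (tail G e) (head G f) \<le> len e + len f \<or>
      p (tail G e) (tail G f) = p (head G e) (tail G f) + len e \<or>
      p (head G e) (head G f) = p (tail G e) (head G f) + len e"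
    using opposite[OF e(2) assms(2,4) ne(3)] e(1) by (simp add: p_def len_arev)
  show "p (head G e) (tail G f) + p (tail G e) (head G f) \<le> len e + len f \<or>
      p (tail G e) (tail G f) = p (tail G e) (head G f) + len f \<or>
      p (head G e) (head G f) = p (head G e) (tail G f) + len f"
    using opposite[OF f(2) assms(1)] ne f(1) by (simp add: p_def sym len_arev algebra_simps)
  fix x y assume "x \<in> {0..len e}" "y \<in> {0..len f}"
  then show "x + y \<le> p (tail G e) (tail G f) \<or> (len e - x) + y \<le> p (head G e) (tail G f) \<or>
      x + (len f - y) \<le> p (tail G e) (head G f) \<or> (len e - x) + (len f - y) \<le> p (head G e) (head G f)"
    using dist_points_le[OF H_dist[OF assms(1,2)] e(1) _ f(1) _ assms(3,4)] by (force simp: p_def)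
qed

text \<open>Geodesics to \<open>tail G f\<close> starting with \<open>e\<close> and with
  \<open>e'\<close> would form a closed walk that is shorter than \<open>2 * pi\<close> and uses
  \<open>e\<close> once.\<close>

lemma no_branch:
  assumes e: "e \<in> H" "e' \<in> H" "e \<noteq> e'" "tail G e = tail G e'" and f: "f \<in> H"
    and lt: "vdist (tail G e) (tail G f) < pi"
    and through: "vdist (tail G e) (tail G f) = vdist (head G e) (tail G f) + len e"
  shows "vdist (tail G e) (tail G f) \<noteq> vdist (head G e') (tail G f) + len e'"
proof
  let ?x = "tail G e" and ?y = "tail G f"
  assume through': "vdist ?x ?y = vdist (head G e') ?y + len e'"
  have arcs: "e \<in> arcs G" "e' \<in> arcs G" using e by (simp_all add: arc)
  have pos: "0 < len e" "0 < len e'" using arcs by (auto intro: len_pos)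
  obtain P where P: "awalk (head G e) P ?y" "edge_path_length P = vdist (head G e) ?y"
    using geodesic[OF H_linked_head[OF e(1) f]] .
  obtain Q where Q: "awalk (head G e') Q ?y" "edge_path_length Q = vdist (head G e') ?y"
    using geodesic[OF H_linked_head[OF e(2) f]] .
  \<comment> \<open>A walk to \<open>?y\<close> that uses \<open>e\<close> in either direction
    visits \<open>?x\<close>, so it is at least as long as the distance from there.\<close>
  have avoid: "e \<notin> set R \<and> arev e \<notin> set R"
    if R: "awalk u R ?y" "edge_path_length R < vdist ?x ?y" for u R
  proof (rule ccontr)
    assume "\<not> ?thesis"
    then obtain g R1 R2 where g: "g = e \<or> g = arev e" and R12: "R = R1 @ g # R2"
      by (auto simp: in_set_conv_decomp)
    then have w: "awalk (tail G g) (g # R2) ?y" "awalk (head G g) R2 ?y" "set R1 \<subseteq> arcs G" "g \<in> arcs G"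
      using R(1) arcs by (auto simp: awalk_Cons_iff)
    then have "edge_path_length R2 \<le> edge_path_length R" "edge_path_length (g # R2) \<le> edge_path_length R"
      using edge_path_length_nonneg[of R1] len_pos[of g] by (auto simp: R12)
    then show False
      using g R(2) vdist_le[OF w(1)] vdist_le[OF w(2)] arcs by auto
  qed
  have "arev e' \<noteq> e"
  proof
    assume "arev e' = e"
    then have "head G e = tail G e" using e(4) arcs by (metis head_arev)
    then show False using through pos by simp
  qed
  moreover have "e \<notin> set P \<and> arev e \<notin> set P" "e \<notin> set Q \<and> arev e \<notin> set Q"
    using avoid[OF P(1)] avoid[OF Q(1)] P(2) Q(2) through through' pos by auto
  moreover have "awalk (head G e') [arev e'] (tail G e)"
    using arc_implies_awalk[of "arev e'"] arcs e(4) by simp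
  from awalk_appendI[OF P(1) awalk_appendI[OF awalk_reverse[OF Q(1)] this]]
  have "awalk (head G e) (P @ reverse_walk Q @ [arev e']) (tail G e)" .
  ultimately have "2 * pi \<le> len e + edge_path_length (P @ reverse_walk Q @ [arev e'])"
    using e(3) arcs(1) by (intro edge_once_length) (auto simp: mem_reverse arev_eq_iff)
  then show False
    using lt through through' P(2) Q length_reverse[of Q] arcs by (auto simp: len_arev)
qed

sublocale taut_graph H "tail G" arev len "\<lambda>u v. pi - vdist u v"
proof (rule taut_graph.intro)
  show "finite H" by (rule H_finite)
next
  fix e assume e: "e \<in> H"
  then have a: "e \<in> arcs G" by (rule arc)
  show "arev e \<in> H" "arev (arev e) = e" "arev e \<noteq> e" "0 < len e" "len (arev e) = len e"
    using e a by (auto simp: H_arev arev_neq len_pos len_arev)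
  have refl: "vdist v v = 0" if "v \<in> verts G" for v
    using vdist_refl that by simp
  show "pi - vdist (tail G e) (tail G e) = pi" using refl a by simp
  \<comment> \<open>If \<open>len e > pi\<close>, the edge and a geodesic between its ends have
    total length exactly \<open>2 * pi\<close>.\<close>
  show "pi - vdist (tail G e) (tail G (arev e)) = \<bar>pi - len e\<bar>"
    using side[OF e H_arev[OF e]] refl[of "head G e"] a vdist_le_pi[OF e H_arev[OF e]]
      vdist_nonneg[OF H_linked[OF e H_arev[OF e]]] len_pos[OF a] by (auto simp: abs_if)
next
  fix e f assume e: "e \<in> H" and f: "f \<in> H"
  show "0 \<le> pi - vdist (tail G e) (tail G f)" using vdist_le_pi[OF e f] by simp
  show "pi - vdist (tail G e) (tail G f) = pi - vdist (tail G f) (tail G e)"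
    using vdist_sym[OF H_linked[OF e f]] by simp
next
  fix e f assume e: "e \<in> H" and f: "f \<in> H" and "f \<noteq> e" "f \<noteq> arev e"
  then show "covered_cell (len e) (len f) (pi - vdist (tail G e) (tail G f)) (pi - vdist (tail G (arev e)) (tail G f))
      (pi - vdist (tail G e) (tail G (arev f))) (pi - vdist (tail G (arev e)) (tail G (arev f)))"
    using covered[OF e f] arc[OF e] arc[OF f] by simp
next
  fix e e' f
  assume *: "e \<in> H" "e' \<in> H" "e \<noteq> e'" "tail G e = tail G e'" "f \<in> H"
    "0 < pi - vdist (tail G e) (tail G f)"
    "pi - vdist (tail G (arev e)) (tail G f) = pi - vdist (tail G e) (tail G f) + len e"
  then show "pi - vdist (tail G (arev e')) (tail G f) \<noteq> pi - vdist (tail G e) (tail G f) + len e'"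
    using no_branch[OF *(1-5)] by (auto simp: arc)
qed

end

section \<open>Closed walks\<close>

context metric_graph
begin

lemma closed_heads:
  assumes "awalk u p u" "p \<noteq> []"
  shows "map (head G) p = rotate1 (map (tail G) p)"
proof -
  have "cas u p u" using assms by auto
  then have "map (tail G) p @ [head G (last p)] = tail G (hd p) # map (head G) p"
    using awalk_verts_conv[of u p] awalk_verts_conv'[of u p u] assms(2) by simp
  moreover have "head G (last p) = u" "tail G (hd p) = u"
    using awlast_of_awalk[OF assms(1)] awhd_of_awalk[OF assms(1)] assms(2)
    by (auto simp: awalk_verts_conv hd_map split: if_splits)
  ultimately show ?thesis
    using assms(2) by (cases p) auto
qed

lemma point_on_circle:
  assumes "awalk u p u" "i < length p" "0 \<le> t" "t < len (p ! i)"
  shows "circle_map p (cis (2 * pi * (edge_path_length (take i p) + t) / edge_path_length p)) = pt (p ! i) t"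
    "edge_path_length (take i p) + t \<in> {0..<edge_path_length p}"
proof -
  have p: "set p \<subseteq> arcs G" "cas u p u" using assms(1) by auto
  have "p = take i p @ p ! i # drop (Suc i) p" using assms(2) by (rule id_take_nth_drop)
  then have "edge_path_length p =
      edge_path_length (take i p) + (len (p ! i) + edge_path_length (drop (Suc i) p))"
    by (metis edge_path_length_simps(2,3))
  moreover have "0 \<le> edge_path_length (take i p)" "0 \<le> edge_path_length (drop (Suc i) p)"
    using p(1) set_take_subset[of i p] set_drop_subset[of "Suc i" p] by (auto intro!: edge_path_length_nonneg)
  ultimately show s: "edge_path_length (take i p) + t \<in> {0..<edge_path_length p}"
    using assms by auto
  show "circle_map p (cis (2 * pi * (edge_path_length (take i p) + t) / edge_path_length p)) = pt (p ! i) t"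
    using s edge_path_map_at[OF p(2,1) assms(2,3)] assms(4)
    by (subst circle_map_cis) auto
qed

lemma pt_in_circle_image:
  assumes "awalk u p u" "a \<in> set p" "t \<in> {0..len a}"
  shows "pt a t \<in> circle_map p ` sphere 0 1"
proof -
  obtain i where i: "i < length p" "a = p ! i" using assms(2) by (auto simp: in_set_conv_nth)
  have arc: "set p \<subseteq> arcs G" "a \<in> arcs G" using assms by auto
  have circle: "circle_map p (cis x) \<in> circle_map p ` sphere 0 1" for x
    by (intro imageI) simp
  show ?thesis
  proof (cases "t = len a")
    case False
    then show ?thesis
      using point_on_circle(1)[OF assms(1) i(1), of t] i assms(3) circle by (metis atLeastAtMost_iff less_le)
  next
    case True
    \<comment> \<open>The parametrisation is half-open on each arc, so the end of \<open>a\<close>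
      is found as the start of the cyclically next arc.\<close>
    have "map (head G) p ! i = rotate1 (map (tail G) p) ! i"
      using closed_heads[OF assms(1)] assms(2) by (cases "p = []") simp_all
    moreover have j: "Suc i mod length p < length p" using i by (intro mod_less_divisor) auto
    ultimately have "head G a = tail G (p ! (Suc i mod length p))"
      using i by (simp add: nth_rotate1)
    moreover have pos: "0 < len (p ! (Suc i mod length p))" using arc(1) nth_mem[OF j] by (auto intro: len_pos)
    ultimately have "pt a t = pt (p ! (Suc i mod length p)) 0"
      using True len_pos[OF arc(2)] by (simp add: pt_def)
    then show ?thesis
      using point_on_circle(1)[OF assms(1) j, of 0] pos circle by (metis order_refl)
  qed
qed

text \<open>Backtracking makes the points at a small arc length \<open>d\<close> before and after
  the junction coincide, against local injectivity.\<close>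

lemma immersed_no_backtrack:
  assumes p: "awalk u p u" and imm: "immersed p" and i: "i < length p"
  shows "p ! (Suc i mod length p) \<noteq> arev (p ! i)"
proof
  let ?j = "Suc i mod length p" and ?L = "edge_path_length p"
  let ?s = "edge_path_length (take (Suc i) p)"
  define z where "z s = cis (2 * pi * s / ?L)" for s
  assume rev: "p ! ?j = arev (p ! i)"
  have arcs: "set p \<subseteq> arcs G" "p ! i \<in> arcs G" using p nth_mem[OF i] by auto
  have j: "?j < length p" using i by (intro mod_less_divisor) auto
  have "p \<noteq> []" using i by auto
  have L: "0 < ?L" using edge_path_length_pos[OF arcs(1) \<open>p \<noteq> []\<close>] .
  have sphere: "z s \<in> sphere 0 1" for s by (simp add: z_def)
  obtain U where U: "open U" "z ?s \<in> U" "inj_on (circle_map p) (U \<inter> sphere 0 1)"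
    using imm sphere unfolding immersed_def locally_injective_on_def by blast
  have "continuous_on UNIV (\<lambda>d. z (?s + d))"
    unfolding z_def using L by (intro continuous_intros) auto
  then have "open ((\<lambda>d. z (?s + d)) -` U)"
    using U(1) by (intro open_vimage)
  moreover have "0 \<in> (\<lambda>d. z (?s + d)) -` U" using U(2) by simp
  ultimately obtain e where e: "0 < e" "ball 0 e \<subseteq> (\<lambda>d. z (?s + d)) -` U"
    using open_contains_ball by metis
  \<comment> \<open>The bounds keep both points in \<open>U\<close> and on their arcs;
    \<open>?L / 2\<close> separates the parameters \<open>d\<close> and \<open>?L - d\<close> that
    arise when the junction is the base point.\<close>
  define d where "d = min (min e (len (p ! i))) (?L / 2) / 2"
  have d: "0 < d" "d < e" "d < len (p ! i)" "d < ?L / 2"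
    using e(1) L len_pos[OF arcs(2)] by (auto simp: d_def min_def)
  have "d \<in> ball 0 e" "- d \<in> ball 0 e" using d by auto
  then have zU: "z (?s + d) \<in> U" "z (?s - d) \<in> U"
    using subsetD[OF e(2), of d] subsetD[OF e(2), of "- d"] by auto
  have s: "?s = edge_path_length (take i p) + len (p ! i)"
    using i by (simp add: take_Suc_conv_app_nth)
  then have s_minus: "edge_path_length (take i p) + (len (p ! i) - d) = ?s - d" by simp
  have minus: "circle_map p (z (?s - d)) = pt (p ! i) (len (p ! i) - d)" "?s - d \<in> {0..<?L}"
    using point_on_circle[OF p i, of "len (p ! i) - d"] d unfolding s_minus z_def by simp_all
  define s' where "s' = edge_path_length (take ?j p) + d"
  have plus: "circle_map p (z s') = pt (arev (p ! i)) d" "s' \<in> {0..<?L}"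
    using point_on_circle[OF p j, of d] d rev arcs(2) unfolding s'_def z_def by (simp_all add: len_arev)
  have s'_cases: "s' = ?s + d \<or> s' = d \<and> ?s = ?L"
  proof (cases "Suc i < length p")
    case False
    then have "Suc i = length p" using i by simp
    then show ?thesis by (simp add: s'_def)
  qed (simp add: s'_def)
  have "z (?L + d) = z d"
  proof -
    have "2 * pi * (?L + d) / ?L = 2 * pi * d / ?L + 2 * pi"
      using L by (simp add: field_simps)
    then show ?thesis by (simp add: z_def flip: cis_mult)
  qed
  then have "z s' \<in> U" using s'_cases zU(1) by auto
  moreover have "pt (arev (p ! i)) d = pt (p ! i) (len (p ! i) - d)"
    using pt_arev[OF arcs(2), of "len (p ! i) - d"] by simp
  ultimately have "z s' = z (?s - d)"
    using U(3) zU(2) sphere minus(1) plus(1) by (intro inj_onD[OF U(3)]) auto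
  moreover have "Arg2pi (z x) = 2 * pi * x / ?L" if "x \<in> {0..<?L}" for x
    unfolding z_def using that L by (intro Arg2pi_unique[of 1]) (auto simp: cis_conv_exp field_simps)
  ultimately have "2 * pi * s' / ?L = 2 * pi * (?s - d) / ?L"
    using minus(2) plus(2) by metis
  then have "s' = ?s - d" using L by simp
  then show False using s'_cases d by auto
qed

text \<open>A repeated tail, or an arc together with its reverse, yields a shorter closed walk.
  Backtracking is excluded inside the list only, not at the base point; this passes to sublists and
  makes the part between \<open>b\<close> and \<open>arev b\<close> nonempty.\<close>

lemma simple_cycle_in_walk:
  assumes "awalk u p u" "p \<noteq> []" "\<And>q a b r. p = q @ a # b # r \<Longrightarrow> b \<noteq> arev a"
  obtains v c where "awalk v c v" "c \<noteq> []" "set c \<subseteq> set p" "distinct (map (tail G) c)"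
    "\<And>a. a \<in> set c \<Longrightarrow> arev a \<notin> set c"
  using assms
proof (induction "length p" arbitrary: u p thesis rule: less_induct)
  case less
  have sub: thesis if eq: "p = q @ r @ s" "r \<noteq> []" "length r < length p" and w: "awalk v r v" for q r s v
  proof -
    have "b \<noteq> arev a" if "r = q' @ a # b # s'" for q' a b s'
      using less.prems(4)[of "q @ q'" a b "s' @ s"] that eq by simp
    then obtain v' c where "awalk v' c v'" "c \<noteq> []" "set c \<subseteq> set r" "distinct (map (tail G) c)"
      "\<And>a. a \<in> set c \<Longrightarrow> arev a \<notin> set c"
      using less.hyps[OF eq(3) _ w eq(2)] by blast
    then show thesis
      by (intro less.prems(1)[of v' c]) (auto simp: eq(1))
  qed
  show ?case
  proof (cases "distinct (map (tail G) p)")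
    case False
    then obtain xs ys zs y where "map (tail G) p = xs @ [y] @ ys @ [y] @ zs"
      using not_distinct_decomp by blast
    then obtain q a r b s where eq: "p = q @ a # r @ b # s" and t: "tail G a = tail G b"
      by (auto simp: map_eq_append_conv append_eq_map_conv Cons_eq_map_conv map_eq_Cons_conv)
    have "awalk (tail G a) (a # r) (tail G a)"
      using less.prems(2) t by (auto simp: eq awalk_Cons_iff)
    then show ?thesis using sub[of q "a # r" "b # s"] eq by simp
  next
    case True
    show ?thesis
    proof (cases "\<exists>a\<in>set p. arev a \<in> set p")
      case False
      then show ?thesis using less.prems True by blast
    next
      case nondisjoint: True
      then obtain a where a: "a \<in> set p" "arev a \<in> set p" by auto
      then have arc: "a \<in> arcs G" using less.prems(2) by auto
      obtain q b r s where eq: "p = q @ b # r @ arev b # s" and b: "b \<in> arcs G"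
      proof -
        obtain q r where q: "p = q @ a # r" using a(1) by (auto simp: in_set_conv_decomp)
        show thesis
        proof (cases "arev a \<in> set r")
          case True
          then obtain r1 r2 where "r = r1 @ arev a # r2" by (auto simp: in_set_conv_decomp)
          then show thesis using that[of q a r1 r2] q arc by simp
        next
          case False
          then have "arev a \<in> set q" using a(2) q arev_neq[OF arc] by auto
          then obtain q1 q2 where "q = q1 @ arev a # q2" by (auto simp: in_set_conv_decomp)
          then show thesis using that[of q1 "arev a" q2 r] q arc by simp
        qed
      qed
      have "r \<noteq> []" using less.prems(4)[of q b "arev b" s] eq by auto
      moreover have "awalk (head G b) r (head G b)"
        using less.prems(2) b by (auto simp: eq awalk_Cons_iff)
      ultimately show ?thesis using sub[of "q @ [b]" r "arev b # s"] eq by simp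
    qed
  qed
qed

end

section \<open>Cycles and closed walks as systems of turns\<close>

context taut_metric_graph
begin

text \<open>At each of its vertices the cycle has exactly two directions, the arc leaving it and the
  reverse of the arc entering it; \<open>star\<close> exchanges them.\<close>

lemma taut_graph_cycle_of_walk:
  assumes c: "awalk v c v" "c \<noteq> []" "set c \<subseteq> H" "distinct (map (tail G) c)"
    and no_rev: "\<And>a. a \<in> set c \<Longrightarrow> arev a \<notin> set c"
  obtains A star where "taut_graph_cycle H (tail G) arev len (\<lambda>u v. pi - vdist u v) A star"
proof -
  define A where "A = set c \<union> arev ` set c"
  define star where "star g = (SOME h. h \<in> A \<and> h \<noteq> g \<and> tail G h = tail G g)" for g
  have arcs: "set c \<subseteq> arcs G" using c(3) arc by auto
  have heads: "map (head G) c = rotate1 (map (tail G) c)"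
    using closed_heads[OF c(1,2)] .
  have inj: "inj_on (tail G) (set c)" using c(4) by (simp add: distinct_map)
  have "distinct (map (head G) c)" using c(4) by (simp add: heads)
  then have inj': "inj_on (head G) (set c)" by (simp add: distinct_map)
  have img: "head G ` set c = tail G ` set c"
    using arg_cong[OF heads, of set] by simp
  have ex1: "\<exists>!h. h \<in> A \<and> h \<noteq> g \<and> tail G h = tail G g" if g: "g \<in> A" for g
  proof (cases "g \<in> set c")
    case True
    then obtain b where b: "b \<in> set c" "head G b = tail G g" using img by force
    show ?thesis
    proof (rule ex1I[of _ "arev b"])
      show "arev b \<in> A \<and> arev b \<noteq> g \<and> tail G (arev b) = tail G g"
        using b True no_rev[of b] arcs by (auto simp: A_def)
      fix h assume h: "h \<in> A \<and> h \<noteq> g \<and> tail G h = tail G g"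
      then have "h \<notin> set c" using inj True by (metis inj_onD)
      then obtain b' where b': "b' \<in> set c" "h = arev b'" using h by (auto simp: A_def)
      then have "head G b' = head G b" using h b arcs by auto
      then show "h = arev b" using inj' b' b by (metis inj_onD)
    qed
  next
    case False
    then obtain a where a: "a \<in> set c" "g = arev a" using g by (auto simp: A_def)
    have tg: "tail G g = head G a" using a arcs by auto
    obtain b where b: "b \<in> set c" "tail G b = head G a" using img a(1) by (metis image_iff)
    show ?thesis
    proof (rule ex1I[of _ b])
      show "b \<in> A \<and> b \<noteq> g \<and> tail G b = tail G g"
        using b False tg by (auto simp: A_def)
      fix h assume h: "h \<in> A \<and> h \<noteq> g \<and> tail G h = tail G g"
      have "h \<in> set c"
      proof (rule ccontr)
        assume "h \<notin> set c"
        then obtain b' where b': "b' \<in> set c" "h = arev b'" using h by (auto simp: A_def)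
        then have "head G b' = head G a" using h tg arcs by auto
        then have "b' = a" using inj' b' a by (metis inj_onD)
        then show False using h b' a by simp
      qed
      then show "h = b" using h b tg inj by (metis inj_onD)
    qed
  qed
  have star: "star g \<in> A \<and> star g \<noteq> g \<and> tail G (star g) = tail G g" if "g \<in> A" for g
    unfolding star_def using ex1[OF that] by (metis (mono_tags, lifting) someI)
  have "taut_graph_cycle H (tail G) arev len (\<lambda>u v. pi - vdist u v) A star"
  proof (intro taut_graph_cycle.intro taut_graph_cycle_axioms.intro taut_graph_axioms)
    show "A \<subseteq> H" "A \<noteq> {}" using c(2,3) H_arev by (auto simp: A_def)
    show "arev g \<in> A" if "g \<in> A" for g using that by (auto simp: A_def)
    show "h = g \<or> h = star g" if "g \<in> A" "h \<in> A" "tail G h = tail G g" for g h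
      using ex1[OF that(1)] star[OF that(1)] that by blast
  qed (use star in auto)
  then show thesis by (rule that)
qed

text \<open>The junction after \<open>p ! i\<close> has the direction back along
  \<open>p ! i\<close> and the direction of the cyclically next arc. The second summand makes the
  system symmetric.\<close>

definition walk_current :: "'b list \<Rightarrow> 'b \<Rightarrow> 'b \<Rightarrow> real" where
  "walk_current p g h = (\<Sum>i<length p. of_bool (g = arev (p ! i) \<and> h = rotate1 p ! i) +
     of_bool (h = arev (p ! i) \<and> g = rotate1 p ! i))"

lemma sum_rotate1: "(\<Sum>i<length p. F (rotate1 p ! i)) = (\<Sum>i<length p. F (p ! i))"
proof -
  have "sum_list (map F (rotate1 p)) = sum_list (map F p)"
    by (cases p) (auto simp: add.commute)
  then show ?thesis
    by (simp add: sum_list_sum_nth atLeast0LessThan)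
qed

text \<open>Each traversal of an arc is seen at the junctions at both its ends, so it counts for
  both orientations.\<close>

lemma mass_walk_current:
  assumes "set p \<subseteq> H" "g \<in> H"
  shows "mass (walk_current p) g = (\<Sum>i<length p. of_bool (g = arev (p ! i)) + of_bool (g = p ! i))"
proof -
  have in_H: "p ! i \<in> H" "rotate1 p ! i \<in> H" if "i < length p" for i
    using that assms(1) nth_mem[of i p] nth_mem[of i "rotate1 p"] by auto
  have "mass (walk_current p) g = (\<Sum>i<length p. \<Sum>h\<in>H. of_bool (g = arev (p ! i)) * of_bool (h = rotate1 p ! i) +
     of_bool (h = arev (p ! i)) * of_bool (g = rotate1 p ! i))"
    unfolding mass_def walk_current_def by (subst sum.swap) (simp add: of_bool_conj)
  also have "\<dots> = (\<Sum>i<length p. of_bool (g = arev (p ! i)) + of_bool (g = rotate1 p ! i))"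
    using in_H H_arev H_finite
    by (intro sum.cong refl)
      (simp add: sum.distrib sum_distrib_left[symmetric] sum_distrib_right[symmetric] of_bool_def)
  also have "\<dots> = (\<Sum>i<length p. of_bool (g = arev (p ! i)) + of_bool (g = p ! i))"
    unfolding sum.distrib using sum_rotate1[of "\<lambda>a. of_bool (g = a) :: real" p] by (simp only:)
  finally show ?thesis .
qed

lemma current_walk_current:
  assumes p: "awalk u p u" "p \<noteq> []" "set p \<subseteq> H"
    and no_back: "\<And>i. i < length p \<Longrightarrow> rotate1 p ! i \<noteq> arev (p ! i)"
  shows "current (walk_current p)"
proof -
  have "mass (walk_current p) (arev g) = mass (walk_current p) g" if "g \<in> H" for g
  proof -
    have "arev g = a \<longleftrightarrow> g = arev a" for a by auto
    then show ?thesis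
      using that p(3) by (simp add: mass_walk_current H_arev arev_eq_iff add.commute)
  qed
  moreover have "walk_current p g h = walk_current p h g" for g h
    by (simp add: walk_current_def add.commute)
  moreover have "0 \<le> walk_current p g h" for g h
    by (auto simp: walk_current_def intro!: sum_nonneg)
  moreover have "g \<noteq> h \<and> tail G g = tail G h" if "walk_current p g h \<noteq> 0" for g h
  proof -
    from that obtain i where "i \<in> {..<length p}"
      "of_bool (g = arev (p ! i) \<and> h = rotate1 p ! i) +
        of_bool (h = arev (p ! i) \<and> g = rotate1 p ! i) \<noteq> (0 :: real)"
      unfolding walk_current_def by (rule sum.not_neutral_contains_not_neutral)
    then have i: "i < length p"
      and gh: "g = arev (p ! i) \<and> h = rotate1 p ! i \<or> h = arev (p ! i) \<and> g = rotate1 p ! i"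
      by (auto simp: of_bool_def split: if_splits)
    have "map (head G) p ! i = rotate1 (map (tail G) p) ! i"
      using closed_heads[OF p(1,2)] by simp
    then have "head G (p ! i) = tail G (rotate1 p ! i)"
      using i by (simp add: rotate1_map)
    moreover have "p ! i \<in> arcs G" using nth_mem[OF i] p(3) arc by auto
    ultimately show ?thesis
      using gh no_back[OF i] by auto
  qed
  ultimately show ?thesis unfolding current_def by blast
qed

lemma current_length_walk_current:
  assumes "set p \<subseteq> H"
  shows "current_length (\<lambda>x. x) (walk_current p) = edge_path_length p"
proof -
  have in_H: "p ! i \<in> H" "arev (p ! i) \<in> H" "len (arev (p ! i)) = len (p ! i)" if "i < length p" for i
    using that assms by (auto intro!: H_arev len_arev arc)
  have "(\<Sum>e\<in>H. mass (walk_current p) e * len e) =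
      (\<Sum>e\<in>H. \<Sum>i<length p. of_bool (e = arev (p ! i)) * len e + of_bool (e = p ! i) * len e)"
    by (intro sum.cong refl) (simp add: mass_walk_current[OF assms] sum_distrib_right distrib_right)
  also have "\<dots> = (\<Sum>i<length p. \<Sum>e\<in>H. of_bool (e = arev (p ! i)) * len e + of_bool (e = p ! i) * len e)"
    by (rule sum.swap)
  also have "\<dots> = (\<Sum>i<length p. 2 * len (p ! i))"
    using in_H H_finite by (intro sum.cong refl) (simp add: sum.distrib of_bool_def if_distrib[of "\<lambda>x. x * _"] cong: if_cong)
  also have "\<dots> = 2 * edge_path_length p"
    by (simp add: edge_path_length_def sum_list_sum_nth atLeast0LessThan sum_distrib_left)
  finally show ?thesis by (simp add: current_length_def)
qed

theorem walk_commensurable: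
  assumes p: "awalk u p u" "p \<noteq> []" "set p \<subseteq> H"
    and no_back: "\<And>i. i < length p \<Longrightarrow> rotate1 p ! i \<noteq> arev (p ! i)"
  shows "commensurable (edge_path_length p) pi"
proof -
  have "b \<noteq> arev a" if "p = q @ a # b # r" for q a b r
  proof -
    have "rotate1 p ! length q = b" "p ! length q = a"
      using that by (simp_all add: nth_rotate1 nth_append)
    then show ?thesis using no_back[of "length q"] that by auto
  qed
  then obtain v c where c: "awalk v c v" "c \<noteq> []" "set c \<subseteq> set p" "distinct (map (tail G) c)"
    "\<And>a. a \<in> set c \<Longrightarrow> arev a \<notin> set c"
    using simple_cycle_in_walk[OF p(1,2)] by metis
  have cH: "set c \<subseteq> H" using c(3) p(3) by auto
  obtain A star where "taut_graph_cycle H (tail G) arev len (\<lambda>u v. pi - vdist u v) A star"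
    using taut_graph_cycle_of_walk[OF c(1,2) cH c(4,5)] .
  then interpret taut_graph_cycle H "tail G" arev len "\<lambda>u v. pi - vdist u v" A star .
  have "\<exists>q\<in>\<rat>. current_length (\<lambda>x. x) (walk_current p) = q * pi"
  proof (rule current_length_rational)
    show "current (walk_current p)" using assms by (rule current_walk_current)
    show "mass (walk_current p) e \<in> \<rat>" if "e \<in> H" for e
      using that by (auto simp: mass_walk_current[OF p(3)])
  qed
  then show ?thesis
    using current_length_walk_current[OF p(3)] by (auto simp: commensurable_def)
qed

end

theorem corollary1p7:
  fixes G :: "('v, 'e) pre_digraph" and arev :: "'e \<Rightarrow> 'e" and len :: "'e \<Rightarrow> real"
    and \<gamma> :: "'e list"
  assumes "metric_graph G arev len"
    and "wf_digraph.closed_w G \<gamma>"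
    and "metric_graph.immersed G arev len \<gamma>"
    and "metric_graph.girth G arev len \<ge> ereal (2 * pi)"
    and "\<And>x y. x \<in> metric_graph.circle_map G arev len \<gamma> ` sphere 0 1 \<Longrightarrow>
               y \<in> metric_graph.circle_map G arev len \<gamma> ` sphere 0 1 \<Longrightarrow>
               metric_graph.mg_dist G arev len x y \<le> ereal pi"
  shows "commensurable (metric_graph.edge_path_length len \<gamma>) pi"
proof -
  interpret metric_graph G arev len by fact
  obtain u where \<gamma>: "awalk u \<gamma> u" "\<gamma> \<noteq> []"
    using assms(2) by (auto simp: closed_w_def)
  define H where "H = set \<gamma> \<union> arev ` set \<gamma>"
  have arcs: "set \<gamma> \<subseteq> arcs G" using \<gamma>(1) by auto
  have linked_u: "linked u (tail G e)" if "e \<in> H" for e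
  proof -
    have v: "tail G e \<in> set (awalk_verts u \<gamma>)"
      using that arcs awalk_verts_arc1[of _ \<gamma> u] awalk_verts_arc2[OF \<gamma>(1)] by (auto simp: H_def)
    then show ?thesis using awalk_decomp[OF \<gamma>(1) v] by (auto simp: linked_def)
  qed
  have image: "pt e x \<in> circle_map \<gamma> ` sphere 0 1" if e: "e \<in> H" "x \<in> {0..len e}" for e x
  proof (cases "e \<in> set \<gamma>")
    case True
    then show ?thesis using pt_in_circle_image[OF \<gamma>(1)] that by simp
  next
    case False
    then obtain a where a: "a \<in> set \<gamma>" "e = arev a" using e by (auto simp: H_def)
    then have "pt e x = pt a (len a - x)" "len e = len a"
      using pt_arev[of a "len a - x"] arcs by (auto simp: len_arev)
    then show ?thesis using pt_in_circle_image[OF \<gamma>(1) a(1), of "len a - x"] that by simp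
  qed
  interpret taut_metric_graph G arev len H
  proof
    show "H \<subseteq> arcs G" "finite H" using arcs by (auto simp: H_def)
    show "arev e \<in> H" if "e \<in> H" for e using that by (auto simp: H_def)
    show "ereal (2 * pi) \<le> girth" by (rule assms(4))
    show "linked (tail G e) (tail G f)" if "e \<in> H" "f \<in> H" for e f
      using linked_u[OF that(1)] linked_u[OF that(2)] linked_sym linked_trans by blast
    show "mg_dist (pt e x) (pt f y) \<le> ereal pi"
      if "e \<in> H" "f \<in> H" "x \<in> {0..len e}" "y \<in> {0..len f}" for e f x y
      using image that by (intro assms(5)) auto
  qed
  show ?thesis
  proof (rule walk_commensurable[OF \<gamma>])
    show "set \<gamma> \<subseteq> H" by (simp add: H_def)
    show "rotate1 \<gamma> ! i \<noteq> arev (\<gamma> ! i)" if "i < length \<gamma>" for i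
      using immersed_no_backtrack[OF \<gamma>(1) assms(3) that] that by (simp add: nth_rotate1)
  qed
qed

end
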